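(* (Fundamental lemma of the calculus of variations) Let $\Omega\subset\mathbb{R}^p$ be open, connected and bounded with smooth boundary, and let $u\in\mathcal{G}(\Omega)$. If $$\int_\Omega u(x)\varphi(x)\,dx=0\quad\text{in }\tilde{\mathbb{R}}$$ for all $\varphi\in\mathcal{G}_c(\Omega)$, then $u\equiv0$ in $\mathcal{G}(\Omega)$.
   Context: $\mathcal{G}(\Omega)=\mathcal{E}_M(\Omega)/\mathcal{N}(\Omega)$ is the (special) Colombeau algebra: $\mathcal{E}_M(\Omega)$ is the set of nets $(u_\varepsilon)_{\varepsilon\in(0,1]}$ in $C^\infty(\Omega)$ such that for every compact $K\subset\Omega$ and every multi-index $\alpha$ there is $N\in\mathbb{N}$ with $\sup_K|\partial^\alpha u_\varepsilon|=O(\varepsilon^{-N})$ as $\varepsilon\to0$; $\mathcal{N}(\Omega)$ is the set of nets such that for all such $K,\alpha$ and all $m\in\mathbb{N}$, $\sup_K|\partial^\alpha u_\varepsilon|=O(\varepsilon^m)$. $\mathcal{G}$ is a sheaf, so elements have supports; $\mathcal{G}_c(\Omega)$ is the set of elements with compact support. $\tilde{\mathbb{R}}$ is the ring of nets of reals with $|x_\varepsilon|=O(\varepsilon^{-N})$ for some $N$, modulo nets with $|x_\varepsilon|=O(\varepsilon^m)$ for all $m$. For $w\in\mathcal{G}_c(\Omega)$, $\int_\Omega w\,dx\in\tilde{\mathbb{R}}$ is the class of $(\int_\Omega w_\varepsilon\,dx)_\varepsilon$, where $(w_\varepsilon)_\varepsilon$ is a representative with supports contained in a fixed compact subset of $\Omega$.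 *)

theory Defs
  imports
    "HOL-Analysis.Analysis"
    "HOL-Library.Landau_Symbols"
    "HOL-Algebra.QuotRing"
begin

section \<open>Smooth functions on open subsets of Euclidean space\<close>

definition partial_deriv :: "'n::finite \<Rightarrow> (real^'n \<Rightarrow> real) \<Rightarrow> (real^'n \<Rightarrow> real)" where
  "partial_deriv i f = (\<lambda>x. deriv (\<lambda>t. f (x + t *\<^sub>R axis i 1)) 0)"

text \<open>
  Higher partial derivatives are indexed by lists of directions: the list \<open>[i\<^sub>1, \<dots>, i\<^sub>k]\<close> stands
  for the multi-index whose \<open>i\<close>-th entry is the number of occurrences of \<open>i\<close>.  Every multi-index
  arises in this way, and for smooth functions on an open set the order of the list is irrelevant
  (Schwarz).
\<close>
definition partial_derivs :: "'n::finite list \<Rightarrow> (real^'n \<Rightarrow> real) \<Rightarrow> (real^'n \<Rightarrow> real)" where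
  "partial_derivs \<alpha> f = foldr partial_deriv \<alpha> f"

text \<open>All functions are total; only their values on the open set \<open>\<Omega>\<close> matter.\<close>
definition C_infinity_on :: "(real^'n::finite) set \<Rightarrow> (real^'n \<Rightarrow> real) \<Rightarrow> bool" where
  "C_infinity_on \<Omega> f \<longleftrightarrow>
     (\<forall>\<alpha>. continuous_on \<Omega> (partial_derivs \<alpha> f) \<and>
          (\<forall>i. \<forall>x\<in>\<Omega>. (\<lambda>t. partial_derivs \<alpha> f (x + t *\<^sub>R axis i 1)) differentiable (at 0)))"

text \<open>
  Near each of its boundary points, \<open>\<Omega>\<close> is the region on one side of the graph of a smooth function,
  after relabelling (\<open>i\<close>) and reorienting (\<open>s\<close>) the coordinate axes.  The function \<open>\<gamma>\<close> of the
  coordinates other than the \<open>i\<close>-th is encoded as a function on the whole space that does not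
  depend on the \<open>i\<close>-th coordinate.
\<close>
definition smooth_boundary :: "(real^'n::finite) set \<Rightarrow> bool" where
  "smooth_boundary \<Omega> \<longleftrightarrow>
     (\<forall>x\<^sub>0 \<in> frontier \<Omega>. \<exists>r>0. \<exists>i. \<exists>s\<in>{1, -1::real}. \<exists>\<gamma>.
        C_infinity_on UNIV \<gamma> \<and> (\<forall>x t. \<gamma> (x + t *\<^sub>R axis i 1) = \<gamma> x) \<and>
        \<Omega> \<inter> ball x\<^sub>0 r = {x \<in> ball x\<^sub>0 r. s * (x $ i) > \<gamma> x})"


section \<open>The special Colombeau algebra\<close>

text \<open>
  Nets indexed by \<open>(0,1]\<close> are total functions of \<open>\<epsilon>\<close>; values at other \<open>\<epsilon>\<close> (and, for nets of functions,
  values outside \<open>\<Omega>\<close>) are unconstrained and are identified by the quotient.  The condition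
  \<open>K \<noteq> {}\<close> is needed because the supremum of the empty set of reals is unspecified.
\<close>
definition moderate_nets :: "(real^'n::finite) set \<Rightarrow> (real \<Rightarrow> real^'n \<Rightarrow> real) set" where
  "moderate_nets \<Omega> =
     {u. (\<forall>\<epsilon>\<in>{0<..1}. C_infinity_on \<Omega> (u \<epsilon>)) \<and>
         (\<forall>K \<alpha>. compact K \<and> K \<noteq> {} \<and> K \<subseteq> \<Omega> \<longrightarrow>
            (\<exists>N::nat. (\<lambda>\<epsilon>. SUP x\<in>K. \<bar>partial_derivs \<alpha> (u \<epsilon>) x\<bar>)
                        \<in> O[at_right 0](\<lambda>\<epsilon>. 1 / \<epsilon> ^ N)))}"

definition negligible_nets :: "(real^'n::finite) set \<Rightarrow> (real \<Rightarrow> real^'n \<Rightarrow> real) set" where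
  "negligible_nets \<Omega> =
     {u. (\<forall>\<epsilon>\<in>{0<..1}. C_infinity_on \<Omega> (u \<epsilon>)) \<and>
         (\<forall>K \<alpha>. compact K \<and> K \<noteq> {} \<and> K \<subseteq> \<Omega> \<longrightarrow>
            (\<forall>m::nat. (\<lambda>\<epsilon>. SUP x\<in>K. \<bar>partial_derivs \<alpha> (u \<epsilon>) x\<bar>)
                        \<in> O[at_right 0](\<lambda>\<epsilon>. \<epsilon> ^ m)))}"

definition moderate_ring :: "(real^'n::finite) set \<Rightarrow> (real \<Rightarrow> real^'n \<Rightarrow> real) ring" where
  "moderate_ring \<Omega> =
     \<lparr>carrier = moderate_nets \<Omega>,
      mult = (\<lambda>u v \<epsilon> x. u \<epsilon> x * v \<epsilon> x), one = (\<lambda>\<epsilon> x. 1),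
      zero = (\<lambda>\<epsilon> x. 0), add = (\<lambda>u v \<epsilon> x. u \<epsilon> x + v \<epsilon> x)\<rparr>"

definition colombeau_algebra :: "(real^'n::finite) set \<Rightarrow> (real \<Rightarrow> real^'n \<Rightarrow> real) set ring" where
  "colombeau_algebra \<Omega> = moderate_ring \<Omega> Quot negligible_nets \<Omega>"

definition colombeau_class ::
    "(real^'n::finite) set \<Rightarrow> (real \<Rightarrow> real^'n \<Rightarrow> real) \<Rightarrow> (real \<Rightarrow> real^'n \<Rightarrow> real) set" where
  "colombeau_class \<Omega> u = negligible_nets \<Omega> +>\<^bsub>moderate_ring \<Omega>\<^esub> u"


section \<open>Generalized real numbers\<close>

definition moderate_reals :: "(real \<Rightarrow> real) set" where
  "moderate_reals = {x. \<exists>N::nat. x \<in> O[at_right 0](\<lambda>\<epsilon>. 1 / \<epsilon> ^ N)}"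

definition negligible_reals :: "(real \<Rightarrow> real) set" where
  "negligible_reals = {x. \<forall>m::nat. x \<in> O[at_right 0](\<lambda>\<epsilon>. \<epsilon> ^ m)}"

definition moderate_real_ring :: "(real \<Rightarrow> real) ring" where
  "moderate_real_ring =
     \<lparr>carrier = moderate_reals,
      mult = (\<lambda>x y \<epsilon>. x \<epsilon> * y \<epsilon>), one = (\<lambda>\<epsilon>. 1),
      zero = (\<lambda>\<epsilon>. 0), add = (\<lambda>x y \<epsilon>. x \<epsilon> + y \<epsilon>)\<rparr>"

definition generalized_reals :: "(real \<Rightarrow> real) set ring" where
  "generalized_reals = moderate_real_ring Quot negligible_reals"

definition generalized_real_class :: "(real \<Rightarrow> real) \<Rightarrow> (real \<Rightarrow> real) set" where
  "generalized_real_class x = negligible_reals +>\<^bsub>moderate_real_ring\<^esub> x"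


section \<open>Support and integration\<close>

text \<open>
  For \<open>V \<subseteq> \<Omega>\<close> open and \<open>W\<close> in the algebra over \<open>\<Omega>\<close>: the class over \<open>V\<close> of a representative of \<open>W\<close>
  (a union of equal classes, as in \<^const>\<open>rcoset_mult\<close>).
\<close>
definition colombeau_restrict ::
    "(real^'n::finite) set \<Rightarrow> (real \<Rightarrow> real^'n \<Rightarrow> real) set \<Rightarrow> (real \<Rightarrow> real^'n \<Rightarrow> real) set" where
  "colombeau_restrict V W = (\<Union>w\<in>W. colombeau_class V w)"

definition colombeau_support ::
    "(real^'n::finite) set \<Rightarrow> (real \<Rightarrow> real^'n \<Rightarrow> real) set \<Rightarrow> (real^'n) set" where
  "colombeau_support \<Omega> W =
     \<Omega> - \<Union>{V. open V \<and> V \<subseteq> \<Omega> \<and> colombeau_restrict V W = \<zero>\<^bsub>colombeau_algebra V\<^esub>}"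

definition colombeau_compact_support ::
    "(real^'n::finite) set \<Rightarrow> (real \<Rightarrow> real^'n \<Rightarrow> real) set set" where
  "colombeau_compact_support \<Omega> =
     {W \<in> carrier (colombeau_algebra \<Omega>). compact (colombeau_support \<Omega> W)}"

text \<open>
  Intended for compactly supported \<open>W\<close>: such a representative then exists, and the resulting class
  does not depend on which one is chosen.
\<close>
definition colombeau_integral ::
    "(real^'n::finite) set \<Rightarrow> (real \<Rightarrow> real^'n \<Rightarrow> real) set \<Rightarrow> (real \<Rightarrow> real) set" where
  "colombeau_integral \<Omega> W =
     (let w = (SOME w. w \<in> W \<and>
                 (\<exists>K. compact K \<and> K \<subseteq> \<Omega> \<and>
                      (\<forall>\<epsilon>\<in>{0<..1}. closure (support_on \<Omega> (w \<epsilon>)) \<subseteq> K)))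
      in generalized_real_class (\<lambda>\<epsilon>. LINT x:\<Omega>|lborel. w \<epsilon> x))"

end

theory Submission
  imports Defs
begin

text \<open>
  Let \<open>v\<close> be a moderate net representing \<open>u\<close>. As in the classical fundamental lemma, the test function
  is built from \<open>u\<close> itself: for a smooth bump \<open>\<psi> \<ge> 0\<close> with compact support in \<open>\<Omega>\<close> and \<open>\<psi> c > 0\<close>, the
  net \<open>\<psi> * v\<close> represents a compactly supported element, so the hypothesis says that
  \<open>\<integral> \<psi> * v\<^sub>\<epsilon>\<^sup>2\<close> is a negligible net of reals. That this holds for the chosen product of representatives,
  and not just for some compactly supported representative of the product class, is
  \<open>integral_negligible_if_colombeau_integral_eq_zero\<close>.

  It remains to pass from small square integrals to small derivatives, and here moderateness
  replaces the continuity argument of the classical proof. The gradient of \<open>v\<^sub>\<epsilon>\<close> near \<open>c\<close> is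
  \<open>O(\<epsilon>\<^sup>-\<^sup>N)\<close>, so on a ball of radius \<open>\<epsilon>\<^sup>k\<close> with \<open>k > N + m\<close> the value of \<open>v\<^sub>\<epsilon>\<close> changes by \<open>O(\<epsilon>\<^sup>m)\<close>
  only. The volume of this ball is a fixed power of \<open>\<epsilon>\<close>, and the integral is smaller than any
  power, so \<open>v\<^sub>\<epsilon> = O(\<epsilon>\<^sup>m)\<close> uniformly near \<open>c\<close>
  (\<open>negligible_near_if_weighted_square_integral_negligible\<close>), hence uniformly on compact sets.

  The derivatives follow from the values: a difference quotient with step \<open>\<epsilon>\<^sup>k\<close> approximates a first
  derivative up to \<open>\<epsilon>\<^sup>k\<close> times a bound for the second derivative, which is again at most a negative
  power of \<open>\<epsilon>\<close> (\<open>negligible_nets_if_zero_order_negligible\<close>).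
\<close>

section \<open>Calculus of iterated partial derivatives\<close>

lemma partial_derivs_Nil [simp]: "partial_derivs [] f = f"
  and partial_derivs_Cons: "partial_derivs (i # \<alpha>) f = partial_deriv i (partial_derivs \<alpha> f)"
  by (simp_all add: partial_derivs_def)

lemma C_infinity_on_imp_continuous_on:
  "C_infinity_on \<Omega> f \<Longrightarrow> continuous_on \<Omega> (partial_derivs \<alpha> f)"
  by (simp add: C_infinity_on_def)

lemma C_infinity_on_imp_continuous_on':
  "C_infinity_on \<Omega> f \<Longrightarrow> continuous_on \<Omega> f"
  using C_infinity_on_imp_continuous_on[of \<Omega> f "[]"] by simp

lemma C_infinity_on_subset: "C_infinity_on \<Omega> f \<Longrightarrow> V \<subseteq> \<Omega> \<Longrightarrow> C_infinity_on V f"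
  by (auto simp: C_infinity_on_def intro: continuous_on_subset)

lemma has_partial_deriv_at_0:
  assumes "C_infinity_on \<Omega> f" "x \<in> \<Omega>"
  shows "((\<lambda>t. partial_derivs \<alpha> f (x + t *\<^sub>R axis i 1)) has_real_derivative
            partial_derivs (i # \<alpha>) f x) (at 0)"
  using assms
  by (auto simp: C_infinity_on_def partial_derivs_Cons partial_deriv_def DERIV_deriv_iff_real_differentiable)

lemma has_partial_deriv:
  assumes "C_infinity_on \<Omega> f" "x + t *\<^sub>R axis i 1 \<in> \<Omega>"
  shows "((\<lambda>t. partial_derivs \<alpha> f (x + t *\<^sub>R axis i 1)) has_real_derivative
            partial_derivs (i # \<alpha>) f (x + t *\<^sub>R axis i 1)) (at t)"
  using has_partial_deriv_at_0[OF assms, of \<alpha>]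
    DERIV_shift[of "\<lambda>t. partial_derivs \<alpha> f (x + t *\<^sub>R axis i 1)"
      "partial_derivs (i # \<alpha>) f (x + t *\<^sub>R axis i 1)" 0 t]
  by (simp add: scaleR_add_left add_ac)

lemma eventually_in_open_along_axis:
  fixes x :: "real^'n::finite"
  assumes "open \<Omega>" "x \<in> \<Omega>"
  shows "\<forall>\<^sub>F t in nhds 0. x + t *\<^sub>R axis i 1 \<in> \<Omega>"
proof -
  have "open ((\<lambda>t::real. x + t *\<^sub>R axis i 1) -` \<Omega>)"
    by (intro open_vimage \<open>open \<Omega>\<close> continuous_intros)
  then show ?thesis
    using \<open>x \<in> \<Omega>\<close> by (auto simp: eventually_nhds)
qed

text \<open>
  To identify all iterated derivatives of \<open>f\<close> at once it suffices to exhibit a family \<open>F\<close> indexed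
  by lists of directions that starts with \<open>f\<close> and in which prepending a direction differentiates.
  Sums, products, functions of one coordinate and locality are all instances of this principle.
\<close>
lemma partial_derivs_unique:
  assumes "open \<Omega>"
    and f: "\<And>x. x \<in> \<Omega> \<Longrightarrow> F [] x = f x"
    and F: "\<And>\<alpha> i x. x \<in> \<Omega> \<Longrightarrow>
              ((\<lambda>t. F \<alpha> (x + t *\<^sub>R axis i 1)) has_real_derivative F (i # \<alpha>) x) (at 0)"
    and "x \<in> \<Omega>"
  shows "partial_derivs \<alpha> f x = F \<alpha> x"
    and "((\<lambda>t. partial_derivs \<alpha> f (x + t *\<^sub>R axis i 1)) has_real_derivative F (i # \<alpha>) x) (at 0)"
proof -
  have deriv: "((\<lambda>t. partial_derivs \<alpha> f (x + t *\<^sub>R axis i 1)) has_real_derivative F (i # \<alpha>) x) (at 0)"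
    if "\<And>x. x \<in> \<Omega> \<Longrightarrow> partial_derivs \<alpha> f x = F \<alpha> x" "x \<in> \<Omega>" for \<alpha> x i
  proof -
    \<comment> \<open>Openness of \<open>\<Omega>\<close> matters here: the two functions agree only on \<open>\<Omega>\<close>, but a derivative at \<open>x\<close>
      depends only on the values near \<open>x\<close>.\<close>
    have "\<forall>\<^sub>F t in nhds 0. partial_derivs \<alpha> f (x + t *\<^sub>R axis i 1) = F \<alpha> (x + t *\<^sub>R axis i 1)"
      using eventually_in_open_along_axis[OF \<open>open \<Omega>\<close> \<open>x \<in> \<Omega>\<close>]
      by (rule eventually_mono) (rule that(1))
    then show ?thesis
      using F[OF \<open>x \<in> \<Omega>\<close>, of \<alpha> i] by (subst DERIV_cong_ev[OF refl _ refl]) auto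
  qed
  have eq: "\<forall>x\<in>\<Omega>. partial_derivs \<alpha> f x = F \<alpha> x" for \<alpha>
  proof (induction \<alpha>)
    case Nil
    then show ?case by (simp add: f)
  next
    case (Cons i \<alpha>)
    then show ?case
      using deriv[of \<alpha> _ i] by (auto simp: partial_derivs_Cons partial_deriv_def intro: DERIV_imp_deriv)
  qed
  then show "partial_derivs \<alpha> f x = F \<alpha> x"
    using \<open>x \<in> \<Omega>\<close> by blast
  show "((\<lambda>t. partial_derivs \<alpha> f (x + t *\<^sub>R axis i 1)) has_real_derivative F (i # \<alpha>) x) (at 0)"
    using deriv eq \<open>x \<in> \<Omega>\<close> by blast
qed

lemma C_infinity_onI:
  assumes "open \<Omega>"
    and f: "\<And>x. x \<in> \<Omega> \<Longrightarrow> F [] x = f x"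
    and cont: "\<And>\<alpha>. continuous_on \<Omega> (F \<alpha>)"
    and F: "\<And>\<alpha> i x. x \<in> \<Omega> \<Longrightarrow>
              ((\<lambda>t. F \<alpha> (x + t *\<^sub>R axis i 1)) has_real_derivative F (i # \<alpha>) x) (at 0)"
  shows "C_infinity_on \<Omega> f"
proof -
  note * = partial_derivs_unique[of \<Omega> F f, OF \<open>open \<Omega>\<close> f F]
  have "continuous_on \<Omega> (partial_derivs \<alpha> f)" for \<alpha>
    using cont[of \<alpha>] *(1) by (simp cong: continuous_on_cong)
  then show ?thesis
    using *(2) unfolding C_infinity_on_def real_differentiable_def by blast
qed

text \<open>
  Functions are total, but on an open set only the values there enter into derivatives; this is
  what makes restriction of nets to smaller open sets well behaved.
\<close>
lemma partial_derivs_local: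
  assumes "open V" "C_infinity_on V g" "\<And>x. x \<in> V \<Longrightarrow> f x = g x"
  shows "x \<in> V \<Longrightarrow> partial_derivs \<alpha> f x = partial_derivs \<alpha> g x" and "C_infinity_on V f"
proof -
  note D = has_partial_deriv_at_0[OF assms(2)]
  show "x \<in> V \<Longrightarrow> partial_derivs \<alpha> f x = partial_derivs \<alpha> g x"
    by (rule partial_derivs_unique[of V "\<lambda>\<alpha>. partial_derivs \<alpha> g"]) (use assms D in auto)
  show "C_infinity_on V f"
    by (rule C_infinity_onI[of V "\<lambda>\<alpha>. partial_derivs \<alpha> g"])
      (use assms D C_infinity_on_imp_continuous_on in auto)
qed

lemma
  fixes c :: real
  assumes "open \<Omega>" "C_infinity_on \<Omega> f" "C_infinity_on \<Omega> g"
  shows partial_derivs_add_cmult: "x \<in> \<Omega> \<Longrightarrow>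
          partial_derivs \<alpha> (\<lambda>x. f x + c * g x) x = partial_derivs \<alpha> f x + c * partial_derivs \<alpha> g x"
    and C_infinity_on_add_cmult: "C_infinity_on \<Omega> (\<lambda>x. f x + c * g x)"
proof -
  let ?F = "\<lambda>\<alpha> x. partial_derivs \<alpha> f x + c * partial_derivs \<alpha> g x"
  have F: "((\<lambda>t. ?F \<alpha> (x + t *\<^sub>R axis i 1)) has_real_derivative ?F (i # \<alpha>) x) (at 0)"
    if "x \<in> \<Omega>" for \<alpha> i x
    using that has_partial_deriv_at_0[OF assms(2)] has_partial_deriv_at_0[OF assms(3)]
    by (intro derivative_intros DERIV_cmult) auto
  show "x \<in> \<Omega> \<Longrightarrow> partial_derivs \<alpha> (\<lambda>x. f x + c * g x) x = ?F \<alpha> x"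
    by (rule partial_derivs_unique[of \<Omega> ?F]) (use assms F in auto)
  show "C_infinity_on \<Omega> (\<lambda>x. f x + c * g x)"
    by (rule C_infinity_onI[of \<Omega> ?F])
      (use assms F in \<open>auto intro!: continuous_intros C_infinity_on_imp_continuous_on\<close>)
qed

text \<open>
  The terms of the iterated Leibniz rule: each direction in \<open>\<alpha>\<close> falls on either the first or the second
  factor. Listing the splits with repetition avoids multinomial coefficients.
\<close>
fun leibniz_splits :: "'a list \<Rightarrow> ('a list \<times> 'a list) list" where
  "leibniz_splits [] = [([], [])]"
| "leibniz_splits (i # \<alpha>) =
     map (\<lambda>(\<beta>, \<gamma>). (i # \<beta>, \<gamma>)) (leibniz_splits \<alpha>) @ map (\<lambda>(\<beta>, \<gamma>). (\<beta>, i # \<gamma>)) (leibniz_splits \<alpha>)"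

definition leibniz_sum ::
    "'n::finite list \<Rightarrow> (real^'n \<Rightarrow> real) \<Rightarrow> (real^'n \<Rightarrow> real) \<Rightarrow> real^'n \<Rightarrow> real" where
  "leibniz_sum \<alpha> f g x =
     (\<Sum>(\<beta>, \<gamma>)\<leftarrow>leibniz_splits \<alpha>. partial_derivs \<beta> f x * partial_derivs \<gamma> g x)"

lemma leibniz_sum_has_partial_deriv:
  assumes "C_infinity_on \<Omega> f" "C_infinity_on \<Omega> g" "x \<in> \<Omega>"
  shows "((\<lambda>t. leibniz_sum \<alpha> f g (x + t *\<^sub>R axis i 1)) has_real_derivative
            leibniz_sum (i # \<alpha>) f g x) (at 0)"
proof -
  have "((\<lambda>t. \<Sum>(\<beta>, \<gamma>)\<leftarrow>L. partial_derivs \<beta> f (x + t *\<^sub>R axis i 1) *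
                        partial_derivs \<gamma> g (x + t *\<^sub>R axis i 1))
          has_real_derivative
          (\<Sum>(\<beta>, \<gamma>)\<leftarrow>map (\<lambda>(\<beta>, \<gamma>). (i # \<beta>, \<gamma>)) L @ map (\<lambda>(\<beta>, \<gamma>). (\<beta>, i # \<gamma>)) L.
              partial_derivs \<beta> f x * partial_derivs \<gamma> g x)) (at 0)" for L
  proof (induction L)
    case Nil
    then show ?case by simp
  next
    case (Cons p L)
    obtain \<beta> \<gamma> where p: "p = (\<beta>, \<gamma>)" by fastforce
    have "((\<lambda>t. partial_derivs \<beta> f (x + t *\<^sub>R axis i 1) * partial_derivs \<gamma> g (x + t *\<^sub>R axis i 1))
            has_real_derivative
            partial_derivs (i # \<beta>) f x * partial_derivs \<gamma> g x +
            partial_derivs \<beta> f x * partial_derivs (i # \<gamma>) g x) (at 0)"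
      using DERIV_mult'[OF has_partial_deriv_at_0[OF assms(1,3)] has_partial_deriv_at_0[OF assms(2,3)],
        of \<beta> i \<gamma>] by (simp add: add_ac)
    from DERIV_add[OF this Cons.IH] show ?case
      by (simp add: p add_ac)
  qed
  then show ?thesis
    unfolding leibniz_sum_def leibniz_splits.simps .
qed

lemma
  assumes "open \<Omega>" "C_infinity_on \<Omega> f" "C_infinity_on \<Omega> g"
  shows partial_derivs_mult: "x \<in> \<Omega> \<Longrightarrow> partial_derivs \<alpha> (\<lambda>x. f x * g x) x = leibniz_sum \<alpha> f g x"
    and C_infinity_on_mult: "C_infinity_on \<Omega> (\<lambda>x. f x * g x)"
proof -
  have Nil: "leibniz_sum [] f g x = f x * g x" for x
    by (simp add: leibniz_sum_def)
  have F: "((\<lambda>t. leibniz_sum \<alpha> f g (x + t *\<^sub>R axis i 1)) has_real_derivative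
            leibniz_sum (i # \<alpha>) f g x) (at 0)" if "x \<in> \<Omega>" for \<alpha> i x
    using leibniz_sum_has_partial_deriv assms that by blast
  have cont: "continuous_on \<Omega> (leibniz_sum \<alpha> f g)" for \<alpha>
  proof -
    have "continuous_on \<Omega> (\<lambda>x. \<Sum>(\<beta>, \<gamma>)\<leftarrow>L. partial_derivs \<beta> f x * partial_derivs \<gamma> g x)" for L
      by (induction L) (auto intro!: continuous_intros C_infinity_on_imp_continuous_on assms)
    then show ?thesis
      unfolding leibniz_sum_def .
  qed
  show "x \<in> \<Omega> \<Longrightarrow> partial_derivs \<alpha> (\<lambda>x. f x * g x) x = leibniz_sum \<alpha> f g x"
    by (rule partial_derivs_unique[of \<Omega> "\<lambda>\<alpha>. leibniz_sum \<alpha> f g"]) (use assms Nil F in auto)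
  show "C_infinity_on \<Omega> (\<lambda>x. f x * g x)"
    by (rule C_infinity_onI[of \<Omega> "\<lambda>\<alpha>. leibniz_sum \<alpha> f g"]) (use assms Nil F cont in auto)
qed

text \<open>
  A derivative in any direction other than \<open>i\<close> kills a function of the \<open>i\<close>-th coordinate, so only
  lists consisting of \<open>i\<close> alone contribute.
\<close>
lemma C_infinity_on_coordinate:
  fixes D :: "nat \<Rightarrow> real \<Rightarrow> real"
  assumes D: "\<And>n t. (D n has_real_derivative D (Suc n) t) (at t)"
  shows "C_infinity_on UNIV (\<lambda>x::real^'n. D 0 (x $ i))"
proof -
  let ?F = "\<lambda>\<alpha> x::real^'n. if set \<alpha> \<subseteq> {i} then D (length \<alpha>) (x $ i) else 0"
  have cont: "continuous_on S (D n)" for n S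
    using D by (meson DERIV_continuous continuous_at_imp_continuous_on)
  show ?thesis
  proof (rule C_infinity_onI[of _ ?F])
    fix \<alpha>
    show "continuous_on UNIV (?F \<alpha>)"
      by (cases "set \<alpha> \<subseteq> {i}")
        (auto intro!: continuous_on_compose2[OF cont[of UNIV]] continuous_intros)
  next
    fix \<alpha> j and x :: "real^'n"
    show "((\<lambda>t. ?F \<alpha> (x + t *\<^sub>R axis j 1)) has_real_derivative ?F (j # \<alpha>) x) (at 0)"
    proof (cases "set \<alpha> \<subseteq> {i} \<and> j = i")
      case True
      then show ?thesis
        using D[of "length \<alpha>" "x $ i"] DERIV_shift[of "D (length \<alpha>)" _ 0 "x $ i"]
        by (simp add: add_ac)
    next
      case False
      then have "?F \<alpha> (x + t *\<^sub>R axis j 1) = ?F \<alpha> x" for t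
        by (auto simp: axis_def)
      with False show ?thesis
        by auto
    qed
  qed auto
qed

lemma C_infinity_on_const: "C_infinity_on UNIV (\<lambda>x::real^'n::finite. c)"
  using C_infinity_on_coordinate[of "\<lambda>n t. if n = 0 then c else 0"] by simp

lemma C_infinity_on_prod:
  assumes "finite I" "open \<Omega>" "\<And>j. j \<in> I \<Longrightarrow> C_infinity_on \<Omega> (f j)"
  shows "C_infinity_on \<Omega> (\<lambda>x. \<Prod>j\<in>I. f j x)"
  using assms(1,3)
proof (induction rule: finite_induct)
  case empty
  then show ?case
    using C_infinity_on_subset[OF C_infinity_on_const[of 1]] by simp
next
  case (insert j I)
  then show ?case
    using C_infinity_on_mult[OF \<open>open \<Omega>\<close>, of "f j" "\<lambda>x. \<Prod>j\<in>I. f j x"] by simp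
qed

section \<open>Smooth bump functions\<close>

text \<open>
  The functions \<open>p(1/t) exp(-1/t)\<close>, extended by zero to \<open>t \<le> 0\<close>. The polynomial factor makes the family
  closed under differentiation, so that smoothness of \<open>exp(-1/t)\<close> needs no formula for its
  higher derivatives.
\<close>
definition flat :: "real poly \<Rightarrow> real \<Rightarrow> real" where
  "flat p t = (if t > 0 then poly p (1 / t) * exp (- 1 / t) else 0)"

lemma poly_div_exp_tendsto_0:
  fixes p :: "real poly"
  shows "((\<lambda>s. poly p s / exp s) \<longlongrightarrow> 0) at_top"
proof -
  have "((\<lambda>s. \<Sum>k\<le>degree p. coeff p k * (s ^ k / exp s)) \<longlongrightarrow> (\<Sum>k\<le>degree p. coeff p k * 0)) at_top"
    by (intro tendsto_intros tendsto_power_div_exp_0)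
  then show ?thesis
    by (simp add: poly_altdef sum_divide_distrib)
qed

lemma flat_has_deriv_at_0: "(flat p has_real_derivative 0) (at 0)"
proof -
  have "((\<lambda>h. flat p h / h) \<longlongrightarrow> 0) (at_right 0)"
  proof (rule Lim_transform_eventually)
    have "((\<lambda>t. poly (monom 1 1 * p) (inverse t) / exp (inverse t)) \<longlongrightarrow> 0) (at_right (0::real))"
      by (rule filterlim_compose[OF poly_div_exp_tendsto_0 filterlim_inverse_at_top_right])
    then show "((\<lambda>t. poly (monom 1 1 * p) (1 / t) / exp (1 / t)) \<longlongrightarrow> 0) (at_right (0::real))"
      by (simp add: inverse_eq_divide)
    have "\<forall>\<^sub>F t in at_right (0::real). t > 0"
      by (simp add: eventually_at_right_less)
    then show "\<forall>\<^sub>F t in at_right 0. poly (monom 1 1 * p) (1 / t) / exp (1 / t) = flat p t / t"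
      by (rule eventually_mono) (simp add: flat_def poly_monom exp_minus field_simps)
  qed
  moreover have "((\<lambda>h. flat p h / h) \<longlongrightarrow> 0) (at_left 0)"
  proof (rule tendsto_eventually)
    have "\<forall>\<^sub>F t in at_left (0::real). t < 0"
      by (auto simp: eventually_at_filter)
    then show "\<forall>\<^sub>F t in at_left 0. flat p t / t = 0"
      by (rule eventually_mono) (simp add: flat_def)
  qed
  ultimately have "((\<lambda>h. flat p h / h) \<longlongrightarrow> 0) (at 0)"
    by (simp add: filterlim_split_at)
  then show ?thesis
    by (simp add: DERIV_def flat_def)
qed

lemma flat_has_deriv:
  "(flat p has_real_derivative flat (monom 1 2 * (p - pderiv p)) t) (at t)"
proof -
  consider "t > 0" | "t = 0" | "t < 0" by linarith
  then show ?thesis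
  proof cases
    case 1
    have "((\<lambda>t. poly p (1 / t) * exp (- 1 / t)) has_real_derivative
            flat (monom 1 2 * (p - pderiv p)) t) (at t)"
      using 1 by (auto intro!: derivative_eq_intros poly_DERIV[THEN DERIV_chain2]
          simp: flat_def poly_monom field_simps power2_eq_square)
    moreover have "\<forall>\<^sub>F s in nhds t. s > 0"
      using 1 by (auto simp: eventually_nhds intro!: exI[of _ "{0<..}"])
    then have "\<forall>\<^sub>F s in nhds t. flat p s = poly p (1 / s) * exp (- 1 / s)"
      by (rule eventually_mono) (simp add: flat_def)
    ultimately show ?thesis
      by (subst DERIV_cong_ev[OF refl _ refl]) auto
  next
    case 2
    then show ?thesis
      using flat_has_deriv_at_0[of p] by (simp add: flat_def)
  next
    case 3
    have "\<forall>\<^sub>F s in nhds t. s < 0"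
      using 3 by (auto simp: eventually_nhds intro!: exI[of _ "{..<0}"])
    then have "\<forall>\<^sub>F s in nhds t. flat p s = 0"
      by (rule eventually_mono) (simp add: flat_def)
    with 3 show ?thesis
      by (subst DERIV_cong_ev[OF refl _ refl]) (auto simp: flat_def)
  qed
qed

lemma C_infinity_on_flat_affine:
  fixes a b :: real
  shows "C_infinity_on UNIV (\<lambda>x::real^'n::finite. flat p (a + b * x $ i))"
proof -
  define P where "P n = ((\<lambda>p. monom 1 2 * (p - pderiv p)) ^^ n) p" for n
  define D where "D n t = b ^ n * flat (P n) (a + b * t)" for n t
  have "(D n has_real_derivative D (Suc n) t) (at t)" for n t
  proof -
    have "((\<lambda>t. a + b * t) has_real_derivative b) (at t)"
      by (auto intro!: derivative_eq_intros)
    from DERIV_cmult[OF DERIV_chain2[OF flat_has_deriv this], of "b ^ n" "P n"] show ?thesis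
      by (simp add: D_def[abs_def] P_def ac_simps)
  qed
  from C_infinity_on_coordinate[of D, OF this] show ?thesis
    by (simp add: D_def P_def)
qed

text \<open>
  A product over the coordinates of one-dimensional bumps \<open>h (r + t) * h (r - t)\<close> with \<open>h t = exp(-1/t)\<close>
  avoids the chain rule for iterated partial derivatives that a radial bump would need. Its support
  is a cube, which lies in the ball of radius \<open>e\<close> if its half side \<open>r\<close> is \<open>e\<close> divided by the dimension.
\<close>
lemma smooth_bump:
  fixes c :: "real^'n::finite"
  assumes "open \<Omega>" "c \<in> \<Omega>"
  obtains \<psi> K where "C_infinity_on UNIV \<psi>" "compact K" "K \<subseteq> \<Omega>" "\<And>x. x \<notin> K \<Longrightarrow> \<psi> x = 0"
    "\<And>x. 0 \<le> \<psi> x" "0 < \<psi> c"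
proof -
  obtain e where e: "e > 0" "cball c e \<subseteq> \<Omega>"
    using assms open_contains_cball by blast
  define r where "r = e / real CARD('n)"
  have r: "r > 0"
    using e by (simp add: r_def)
  define \<psi> where "\<psi> x = (\<Prod>i\<in>UNIV. flat 1 ((r - c $ i) + 1 * x $ i) * flat 1 ((r + c $ i) + (-1) * x $ i))"
    for x :: "real^'n"
  show thesis
  proof (rule that)
    show "C_infinity_on UNIV \<psi>"
      unfolding \<psi>_def
      by (intro C_infinity_on_prod C_infinity_on_mult C_infinity_on_flat_affine) auto
    show "compact (cball c e)" "cball c e \<subseteq> \<Omega>"
      using e by auto
    show "\<psi> x = 0" if "x \<notin> cball c e" for x
    proof -
      have "\<exists>i. r < \<bar>x $ i - c $ i\<bar>"
      proof (rule ccontr)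
        assume "\<not> ?thesis"
        then have "(\<Sum>i\<in>UNIV. \<bar>(x - c) $ i\<bar>) \<le> (\<Sum>i\<in>(UNIV::'n set). r)"
          by (intro sum_mono) (auto simp: not_less)
        then have "norm (x - c) \<le> e"
          using norm_le_l1_cart[of "x - c"] by (simp add: r_def)
        with that show False
          by (simp add: dist_norm norm_minus_commute)
      qed
      then obtain i where "r < \<bar>x $ i - c $ i\<bar>" ..
      then have "flat 1 ((r - c $ i) + 1 * x $ i) * flat 1 ((r + c $ i) + (-1) * x $ i) = 0"
        by (auto simp: flat_def)
      then show ?thesis
        unfolding \<psi>_def by (intro prod_zero) auto
    qed
    show "0 \<le> \<psi> x" for x
      unfolding \<psi>_def by (intro prod_nonneg) (auto simp: flat_def)
    show "0 < \<psi> c"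
      unfolding \<psi>_def using r by (intro prod_pos) (auto simp: flat_def)
  qed
qed

section \<open>Uniform estimates for nets\<close>

text \<open>
  The growth conditions without suprema: pointwise inequalities with a common constant can be added
  and multiplied without checking that the functions are bounded, and \<open>K\<close> may be empty or open.
\<close>
definition uniform_bigo :: "'a set \<Rightarrow> (real \<Rightarrow> 'a \<Rightarrow> real) \<Rightarrow> (real \<Rightarrow> real) \<Rightarrow> bool" where
  "uniform_bigo K f g \<longleftrightarrow> (\<exists>C. \<forall>\<^sub>F \<epsilon> in at_right 0. \<forall>x\<in>K. \<bar>f \<epsilon> x\<bar> \<le> C * g \<epsilon>)"

lemma uniform_bigoI:
  "\<forall>\<^sub>F \<epsilon> in at_right 0. \<forall>x\<in>K. \<bar>f \<epsilon> x\<bar> \<le> C * g \<epsilon> \<Longrightarrow> uniform_bigo K f g"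
  unfolding uniform_bigo_def by blast

lemma uniform_bigoE:
  assumes "uniform_bigo K f g"
  obtains C where "\<forall>\<^sub>F \<epsilon> in at_right 0. \<forall>x\<in>K. \<bar>f \<epsilon> x\<bar> \<le> C * g \<epsilon>"
  using assms unfolding uniform_bigo_def by blast

lemma eventually_at_right_0_unit: "\<forall>\<^sub>F \<epsilon> in at_right (0::real). \<epsilon> \<in> {0<..<1}"
  by (rule eventually_at_right_real) simp

lemma eventually_power_less:
  assumes "d > 0"
  shows "\<forall>\<^sub>F \<epsilon> in at_right (0::real). \<epsilon> ^ Suc k < d"
proof -
  have "((\<lambda>\<epsilon>::real. \<epsilon> ^ Suc k) \<longlongrightarrow> 0 ^ Suc k) (at_right 0)"
    by (intro tendsto_intros)
  then show ?thesis
    using assms by (intro order_tendstoD) auto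
qed

lemma SUP_bigo_iff_uniform_bigo:
  fixes f :: "real \<Rightarrow> 'a::topological_space \<Rightarrow> real"
  assumes "compact K" "K \<noteq> {}" "\<And>\<epsilon>. \<epsilon> \<in> {0<..1} \<Longrightarrow> continuous_on K (f \<epsilon>)"
    and g: "\<And>\<epsilon>. \<epsilon> > 0 \<Longrightarrow> g \<epsilon> > 0"
  shows "(\<lambda>\<epsilon>. SUP x\<in>K. \<bar>f \<epsilon> x\<bar>) \<in> O[at_right 0](g) \<longleftrightarrow> uniform_bigo K f g"
proof -
  have iff: "norm (SUP x\<in>K. \<bar>f \<epsilon> x\<bar>) \<le> C * norm (g \<epsilon>) \<longleftrightarrow> (\<forall>x\<in>K. \<bar>f \<epsilon> x\<bar> \<le> C * g \<epsilon>)"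
    if "\<epsilon> \<in> {0<..<1}" for \<epsilon> C
  proof -
    have "continuous_on K (\<lambda>x. \<bar>f \<epsilon> x\<bar>)"
      using that by (intro continuous_intros assms) auto
    then have bdd: "bdd_above ((\<lambda>x. \<bar>f \<epsilon> x\<bar>) ` K)"
      by (intro bounded_imp_bdd_above compact_imp_bounded compact_continuous_image \<open>compact K\<close>)
    obtain x where "x \<in> K"
      using \<open>K \<noteq> {}\<close> by blast
    have "0 \<le> (SUP x\<in>K. \<bar>f \<epsilon> x\<bar>)"
      using cSUP_upper[OF \<open>x \<in> K\<close> bdd] abs_ge_zero[of "f \<epsilon> x"] by linarith
    then show ?thesis
      using g[of \<epsilon>] that cSUP_le_iff[OF \<open>K \<noteq> {}\<close> bdd] by simp
  qed
  have "(\<forall>\<^sub>F \<epsilon> in at_right 0. norm (SUP x\<in>K. \<bar>f \<epsilon> x\<bar>) \<le> C * norm (g \<epsilon>)) \<longleftrightarrow>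
        (\<forall>\<^sub>F \<epsilon> in at_right 0. \<forall>x\<in>K. \<bar>f \<epsilon> x\<bar> \<le> C * g \<epsilon>)" for C
    by (rule eventually_subst[OF eventually_mono[OF eventually_at_right_0_unit iff]])
  note ev = this
  show ?thesis
  proof
    assume "(\<lambda>\<epsilon>. SUP x\<in>K. \<bar>f \<epsilon> x\<bar>) \<in> O[at_right 0](g)"
    then obtain C where "\<forall>\<^sub>F \<epsilon> in at_right 0. norm (SUP x\<in>K. \<bar>f \<epsilon> x\<bar>) \<le> C * norm (g \<epsilon>)"
      by (rule landau_o.bigE)
    then show "uniform_bigo K f g"
      unfolding ev by (rule uniform_bigoI)
  next
    assume "uniform_bigo K f g"
    then obtain C where "\<forall>\<^sub>F \<epsilon> in at_right 0. norm (SUP x\<in>K. \<bar>f \<epsilon> x\<bar>) \<le> C * norm (g \<epsilon>)"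
      unfolding ev by (rule uniform_bigoE)
    then show "(\<lambda>\<epsilon>. SUP x\<in>K. \<bar>f \<epsilon> x\<bar>) \<in> O[at_right 0](g)"
      by (rule bigoI)
  qed
qed

lemma moderate_nets_iff:
  fixes u :: "real \<Rightarrow> real^'n::finite \<Rightarrow> real"
  shows
  "u \<in> moderate_nets \<Omega> \<longleftrightarrow>
     (\<forall>\<epsilon>\<in>{0<..1}. C_infinity_on \<Omega> (u \<epsilon>)) \<and>
     (\<forall>K \<alpha>. compact K \<and> K \<subseteq> \<Omega> \<longrightarrow>
        (\<exists>N::nat. uniform_bigo K (\<lambda>\<epsilon>. partial_derivs \<alpha> (u \<epsilon>)) (\<lambda>\<epsilon>. 1 / \<epsilon> ^ N)))"
proof (cases "\<forall>\<epsilon>\<in>{0<..1}. C_infinity_on \<Omega> (u \<epsilon>)")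
  case True
  then have "continuous_on K (partial_derivs \<alpha> (u \<epsilon>))" if "K \<subseteq> \<Omega>" "\<epsilon> \<in> {0<..1}" for K \<epsilon> \<alpha>
    using that by (meson C_infinity_on_imp_continuous_on continuous_on_subset)
  then have "(\<lambda>\<epsilon>. SUP x\<in>K. \<bar>partial_derivs \<alpha> (u \<epsilon>) x\<bar>) \<in> O[at_right 0](\<lambda>\<epsilon>. 1 / \<epsilon> ^ N) \<longleftrightarrow>
        uniform_bigo K (\<lambda>\<epsilon>. partial_derivs \<alpha> (u \<epsilon>)) (\<lambda>\<epsilon>. 1 / \<epsilon> ^ N)"
    if "compact K" "K \<noteq> {}" "K \<subseteq> \<Omega>" for K \<alpha> N
    using that by (intro SUP_bigo_iff_uniform_bigo) auto
  moreover have "uniform_bigo {} f g" for f :: "real \<Rightarrow> real^'n \<Rightarrow> real" and g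
    by (simp add: uniform_bigo_def)
  ultimately have "(K \<noteq> {} \<longrightarrow> (\<exists>N. (\<lambda>\<epsilon>. SUP x\<in>K. \<bar>partial_derivs \<alpha> (u \<epsilon>) x\<bar>) \<in> O[at_right 0](\<lambda>\<epsilon>. 1 / \<epsilon> ^ N))) \<longleftrightarrow>
      (\<exists>N. uniform_bigo K (\<lambda>\<epsilon>. partial_derivs \<alpha> (u \<epsilon>)) (\<lambda>\<epsilon>. 1 / \<epsilon> ^ N))"
    if "compact K" "K \<subseteq> \<Omega>" for K \<alpha>
    using that by (cases "K = {}") simp_all
  note iff = this
  show ?thesis (is "_ \<longleftrightarrow> _ \<and> (\<forall>K \<alpha>. ?Q K \<alpha>)")
    unfolding moderate_nets_def mem_Collect_eq
  proof (intro conj_cong[OF refl] all_cong1)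
    fix K \<alpha>
    show "(compact K \<and> K \<noteq> {} \<and> K \<subseteq> \<Omega> \<longrightarrow>
            (\<exists>N. (\<lambda>\<epsilon>. SUP x\<in>K. \<bar>partial_derivs \<alpha> (u \<epsilon>) x\<bar>) \<in> O[at_right 0](\<lambda>\<epsilon>. 1 / \<epsilon> ^ N))) \<longleftrightarrow>
          ?Q K \<alpha>"
    proof (cases "compact K \<and> K \<subseteq> \<Omega>")
      case True
      then show ?thesis
        using iff[of K \<alpha>] by simp
    next
      case False
      then show ?thesis
        by blast
    qed
  qed
qed (auto simp: moderate_nets_def)

lemma negligible_nets_iff:
  fixes u :: "real \<Rightarrow> real^'n::finite \<Rightarrow> real"
  shows
  "u \<in> negligible_nets \<Omega> \<longleftrightarrow>
     (\<forall>\<epsilon>\<in>{0<..1}. C_infinity_on \<Omega> (u \<epsilon>)) \<and>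
     (\<forall>K \<alpha>. compact K \<and> K \<subseteq> \<Omega> \<longrightarrow>
        (\<forall>m. uniform_bigo K (\<lambda>\<epsilon>. partial_derivs \<alpha> (u \<epsilon>)) (\<lambda>\<epsilon>. \<epsilon> ^ m)))"
proof (cases "\<forall>\<epsilon>\<in>{0<..1}. C_infinity_on \<Omega> (u \<epsilon>)")
  case True
  then have "continuous_on K (partial_derivs \<alpha> (u \<epsilon>))" if "K \<subseteq> \<Omega>" "\<epsilon> \<in> {0<..1}" for K \<epsilon> \<alpha>
    using that by (meson C_infinity_on_imp_continuous_on continuous_on_subset)
  then have "(\<lambda>\<epsilon>. SUP x\<in>K. \<bar>partial_derivs \<alpha> (u \<epsilon>) x\<bar>) \<in> O[at_right 0](\<lambda>\<epsilon>. \<epsilon> ^ N) \<longleftrightarrow>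
        uniform_bigo K (\<lambda>\<epsilon>. partial_derivs \<alpha> (u \<epsilon>)) (\<lambda>\<epsilon>. \<epsilon> ^ N)"
    if "compact K" "K \<noteq> {}" "K \<subseteq> \<Omega>" for K \<alpha> N
    using that by (intro SUP_bigo_iff_uniform_bigo) auto
  moreover have "uniform_bigo {} f g" for f :: "real \<Rightarrow> real^'n \<Rightarrow> real" and g
    by (simp add: uniform_bigo_def)
  ultimately have "(K \<noteq> {} \<longrightarrow> (\<forall>N. (\<lambda>\<epsilon>. SUP x\<in>K. \<bar>partial_derivs \<alpha> (u \<epsilon>) x\<bar>) \<in> O[at_right 0](\<lambda>\<epsilon>. \<epsilon> ^ N))) \<longleftrightarrow>
      (\<forall>N. uniform_bigo K (\<lambda>\<epsilon>. partial_derivs \<alpha> (u \<epsilon>)) (\<lambda>\<epsilon>. \<epsilon> ^ N))"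
    if "compact K" "K \<subseteq> \<Omega>" for K \<alpha>
    using that by (cases "K = {}") simp_all
  note iff = this
  show ?thesis (is "_ \<longleftrightarrow> _ \<and> (\<forall>K \<alpha>. ?Q K \<alpha>)")
    unfolding negligible_nets_def mem_Collect_eq
  proof (intro conj_cong[OF refl] all_cong1)
    fix K \<alpha>
    show "(compact K \<and> K \<noteq> {} \<and> K \<subseteq> \<Omega> \<longrightarrow>
            (\<forall>N. (\<lambda>\<epsilon>. SUP x\<in>K. \<bar>partial_derivs \<alpha> (u \<epsilon>) x\<bar>) \<in> O[at_right 0](\<lambda>\<epsilon>. \<epsilon> ^ N))) \<longleftrightarrow>
          ?Q K \<alpha>"
    proof (cases "compact K \<and> K \<subseteq> \<Omega>")
      case True
      then show ?thesis
        using iff[of K \<alpha>] by simp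
    next
      case False
      then show ?thesis
        by blast
    qed
  qed
qed (auto simp: negligible_nets_def)

lemma uniform_bigo_subset: "uniform_bigo K f g \<Longrightarrow> L \<subseteq> K \<Longrightarrow> uniform_bigo L f g"
  by (erule uniform_bigoE, rule uniform_bigoI) (auto elim!: eventually_mono)

lemma uniform_bigo_cong:
  assumes "uniform_bigo K f g" "\<And>\<epsilon> x. \<epsilon> \<in> {0<..1} \<Longrightarrow> x \<in> K \<Longrightarrow> f' \<epsilon> x = f \<epsilon> x"
  shows "uniform_bigo K f' g"
proof -
  obtain C where "\<forall>\<^sub>F \<epsilon> in at_right 0. \<forall>x\<in>K. \<bar>f \<epsilon> x\<bar> \<le> C * g \<epsilon>"
    using assms(1) by (rule uniform_bigoE)
  then have "\<forall>\<^sub>F \<epsilon> in at_right 0. \<forall>x\<in>K. \<bar>f' \<epsilon> x\<bar> \<le> C * g \<epsilon>"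
    using eventually_at_right_0_unit by eventually_elim (simp add: assms(2))
  then show ?thesis
    by (rule uniform_bigoI)
qed

lemma uniform_bigo_add_cmult:
  fixes c :: real
  assumes "uniform_bigo K f h" "uniform_bigo K g h"
  shows "uniform_bigo K (\<lambda>\<epsilon> x. f \<epsilon> x + c * g \<epsilon> x) h"
proof -
  obtain A where "\<forall>\<^sub>F \<epsilon> in at_right 0. \<forall>x\<in>K. \<bar>f \<epsilon> x\<bar> \<le> A * h \<epsilon>"
    using assms(1) by (rule uniform_bigoE)
  moreover obtain B where "\<forall>\<^sub>F \<epsilon> in at_right 0. \<forall>x\<in>K. \<bar>g \<epsilon> x\<bar> \<le> B * h \<epsilon>"
    using assms(2) by (rule uniform_bigoE)
  ultimately have "\<forall>\<^sub>F \<epsilon> in at_right 0. \<forall>x\<in>K. \<bar>f \<epsilon> x + c * g \<epsilon> x\<bar> \<le> (A + \<bar>c\<bar> * B) * h \<epsilon>"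
  proof eventually_elim
    case (elim \<epsilon>)
    show ?case
    proof
      fix x assume "x \<in> K"
      have "\<bar>f \<epsilon> x + c * g \<epsilon> x\<bar> \<le> \<bar>f \<epsilon> x\<bar> + \<bar>c\<bar> * \<bar>g \<epsilon> x\<bar>"
        by (metis abs_mult abs_triangle_ineq)
      also have "\<dots> \<le> A * h \<epsilon> + \<bar>c\<bar> * (B * h \<epsilon>)"
        using elim \<open>x \<in> K\<close> by (intro add_mono mult_left_mono) auto
      finally show "\<bar>f \<epsilon> x + c * g \<epsilon> x\<bar> \<le> (A + \<bar>c\<bar> * B) * h \<epsilon>"
        by (simp add: algebra_simps)
    qed
  qed
  then show ?thesis
    by (rule uniform_bigoI)
qed

lemma uniform_bigo_mult:
  assumes "uniform_bigo K f g" "uniform_bigo K f' g'"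
  shows "uniform_bigo K (\<lambda>\<epsilon> x. f \<epsilon> x * f' \<epsilon> x) (\<lambda>\<epsilon>. g \<epsilon> * g' \<epsilon>)"
proof -
  obtain A where "\<forall>\<^sub>F \<epsilon> in at_right 0. \<forall>x\<in>K. \<bar>f \<epsilon> x\<bar> \<le> A * g \<epsilon>"
    using assms(1) by (rule uniform_bigoE)
  moreover obtain B where "\<forall>\<^sub>F \<epsilon> in at_right 0. \<forall>x\<in>K. \<bar>f' \<epsilon> x\<bar> \<le> B * g' \<epsilon>"
    using assms(2) by (rule uniform_bigoE)
  ultimately have "\<forall>\<^sub>F \<epsilon> in at_right 0. \<forall>x\<in>K. \<bar>f \<epsilon> x * f' \<epsilon> x\<bar> \<le> (A * B) * (g \<epsilon> * g' \<epsilon>)"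
  proof eventually_elim
    case (elim \<epsilon>)
    show ?case
    proof
      fix x assume "x \<in> K"
      have "\<bar>f \<epsilon> x\<bar> * \<bar>f' \<epsilon> x\<bar> \<le> (A * g \<epsilon>) * (B * g' \<epsilon>)"
        using elim \<open>x \<in> K\<close> by (intro mult_mono) (auto intro: order_trans[OF abs_ge_zero])
      then show "\<bar>f \<epsilon> x * f' \<epsilon> x\<bar> \<le> (A * B) * (g \<epsilon> * g' \<epsilon>)"
        by (simp add: abs_mult mult_ac)
    qed
  qed
  then show ?thesis
    by (rule uniform_bigoI)
qed

lemma uniform_bigo_mono:
  assumes "uniform_bigo K f g" "\<And>\<epsilon>. \<epsilon> \<in> {0<..<1} \<Longrightarrow> 0 \<le> g \<epsilon> \<and> g \<epsilon> \<le> h \<epsilon>"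
  shows "uniform_bigo K f h"
proof -
  obtain A where "\<forall>\<^sub>F \<epsilon> in at_right 0. \<forall>x\<in>K. \<bar>f \<epsilon> x\<bar> \<le> A * g \<epsilon>"
    using assms(1) by (rule uniform_bigoE)
  then have "\<forall>\<^sub>F \<epsilon> in at_right 0. \<forall>x\<in>K. \<bar>f \<epsilon> x\<bar> \<le> \<bar>A\<bar> * h \<epsilon>"
    using eventually_at_right_0_unit
  proof eventually_elim
    case (elim \<epsilon>)
    have "A * g \<epsilon> \<le> \<bar>A\<bar> * h \<epsilon>"
      using assms(2)[OF elim(2)] by (intro mult_mono) auto
    then have "a \<le> \<bar>A\<bar> * h \<epsilon>" if "a \<le> A * g \<epsilon>" for a
      using that by linarith
    with elim(1) show ?case
      by blast
  qed
  then show ?thesis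
    by (rule uniform_bigoI)
qed

lemma uniform_bigo_inverse_power_mono:
  assumes "uniform_bigo K f (\<lambda>\<epsilon>. 1 / \<epsilon> ^ M)" "M \<le> N"
  shows "uniform_bigo K f (\<lambda>\<epsilon>. 1 / \<epsilon> ^ N)"
  by (rule uniform_bigo_mono[OF assms(1)]) (use assms(2) in \<open>auto intro!: divide_left_mono power_decreasing\<close>)

lemma uniform_bigo_const_net:
  assumes "compact K" "continuous_on K f"
  shows "uniform_bigo K (\<lambda>\<epsilon>. f) (\<lambda>\<epsilon>. 1 / \<epsilon> ^ 0)"
proof -
  have "bounded (f ` K)"
    by (intro compact_imp_bounded compact_continuous_image assms)
  then obtain B where "\<forall>x\<in>K. \<bar>f x\<bar> \<le> B"
    by (auto simp: bounded_real)
  then show ?thesis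
    by (intro uniform_bigoI[of _ _ B]) simp
qed

lemma uniform_bigo_Un:
  assumes "uniform_bigo A f g" "uniform_bigo B f g" "\<And>\<epsilon>. \<epsilon> \<in> {0<..<1} \<Longrightarrow> 0 \<le> g \<epsilon>"
  shows "uniform_bigo (A \<union> B) f g"
proof -
  obtain a where "\<forall>\<^sub>F \<epsilon> in at_right 0. \<forall>x\<in>A. \<bar>f \<epsilon> x\<bar> \<le> a * g \<epsilon>"
    using assms(1) by (rule uniform_bigoE)
  moreover obtain b where "\<forall>\<^sub>F \<epsilon> in at_right 0. \<forall>x\<in>B. \<bar>f \<epsilon> x\<bar> \<le> b * g \<epsilon>"
    using assms(2) by (rule uniform_bigoE)
  ultimately have "\<forall>\<^sub>F \<epsilon> in at_right 0. \<forall>x\<in>A \<union> B. \<bar>f \<epsilon> x\<bar> \<le> max a b * g \<epsilon>"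
    using eventually_at_right_0_unit
  proof eventually_elim
    case (elim \<epsilon>)
    have "a * g \<epsilon> \<le> max a b * g \<epsilon>" "b * g \<epsilon> \<le> max a b * g \<epsilon>"
      using assms(3)[OF elim(3)] by (auto intro!: mult_right_mono)
    then have "y \<le> max a b * g \<epsilon>" if "y \<le> a * g \<epsilon> \<or> y \<le> b * g \<epsilon>" for y
      using that by linarith
    with elim(1,2) show ?case
      by blast
  qed
  then show ?thesis
    by (rule uniform_bigoI)
qed

lemma uniform_bigo_compact:
  fixes K :: "'a::topological_space set"
  assumes "compact K" "\<And>\<epsilon>. \<epsilon> \<in> {0<..<1} \<Longrightarrow> 0 \<le> g \<epsilon>"
    and loc: "\<And>c. c \<in> K \<Longrightarrow> \<exists>U. open U \<and> c \<in> U \<and> uniform_bigo U f g"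
  shows "uniform_bigo K f g"
proof -
  define \<U> where "\<U> = {U. open U \<and> uniform_bigo U f g}"
  have "K \<subseteq> \<Union>\<U>"
    using loc unfolding \<U>_def by fast
  moreover have "open U" if "U \<in> \<U>" for U
    using that by (simp add: \<U>_def)
  ultimately obtain D where D: "D \<subseteq> \<U>" "finite D" "K \<subseteq> \<Union>D"
    using compactE[OF \<open>compact K\<close>, of \<U>] by metis
  from D(2,1) have "uniform_bigo (\<Union>D) f g"
  proof (induction rule: finite_induct)
    case empty
    then show ?case by (simp add: uniform_bigo_def)
  next
    case (insert U D)
    then have "uniform_bigo U f g" "uniform_bigo (\<Union>D) f g"
      by (simp_all add: \<U>_def)
    then have "uniform_bigo (U \<union> \<Union>D) f g"
      using assms(2) by (rule uniform_bigo_Un)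
    then show ?case
      by simp
  qed
  then show ?thesis
    using D(3) by (rule uniform_bigo_subset)
qed

section \<open>Moderate and negligible nets\<close>

lemma moderate_nets_imp_continuous_on:
  "u \<in> moderate_nets \<Omega> \<Longrightarrow> \<epsilon> \<in> {0<..1} \<Longrightarrow> continuous_on \<Omega> (u \<epsilon>)"
  by (simp add: moderate_nets_iff C_infinity_on_imp_continuous_on')

lemma moderate_nets_const:
  assumes "C_infinity_on \<Omega> f"
  shows "(\<lambda>\<epsilon>. f) \<in> moderate_nets \<Omega>"
  unfolding moderate_nets_iff
proof (intro conjI ballI allI impI)
  fix K \<alpha> assume "compact K \<and> K \<subseteq> \<Omega>"
  then show "\<exists>N. uniform_bigo K (\<lambda>\<epsilon>. partial_derivs \<alpha> f) (\<lambda>\<epsilon>. 1 / \<epsilon> ^ N)"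
    using continuous_on_subset[OF C_infinity_on_imp_continuous_on[OF assms]]
    by (intro exI[of _ 0] uniform_bigo_const_net) auto
qed (rule assms)

text \<open>
  By the Leibniz rule each derivative of the product is a fixed finite sum of products of derivatives
  of the factors, and exponents add.
\<close>
lemma moderate_nets_mult:
  assumes "open \<Omega>" "u \<in> moderate_nets \<Omega>" "v \<in> moderate_nets \<Omega>"
  shows "(\<lambda>\<epsilon> x. u \<epsilon> x * v \<epsilon> x) \<in> moderate_nets \<Omega>"
  unfolding moderate_nets_iff
proof (intro conjI ballI allI impI)
  have smooth: "C_infinity_on \<Omega> (u \<epsilon>)" "C_infinity_on \<Omega> (v \<epsilon>)" if "\<epsilon> \<in> {0<..1}" for \<epsilon>
    using assms that by (auto simp: moderate_nets_iff)
  then show "C_infinity_on \<Omega> (\<lambda>x. u \<epsilon> x * v \<epsilon> x)" if "\<epsilon> \<in> {0<..1}" for \<epsilon>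
    using that assms(1) by (intro C_infinity_on_mult)
  fix K \<alpha> assume K: "compact K \<and> K \<subseteq> \<Omega>"
  have "\<exists>N. uniform_bigo K
          (\<lambda>\<epsilon> x. \<Sum>(\<beta>, \<gamma>)\<leftarrow>L. partial_derivs \<beta> (u \<epsilon>) x * partial_derivs \<gamma> (v \<epsilon>) x) (\<lambda>\<epsilon>. 1 / \<epsilon> ^ N)" for L
  proof (induction L)
    case Nil
    then show ?case
      by (auto intro!: exI[of _ 0] uniform_bigoI[of _ _ 0])
  next
    case (Cons p L)
    obtain \<beta> \<gamma> where p: "p = (\<beta>, \<gamma>)" by fastforce
    obtain N where N: "uniform_bigo K
        (\<lambda>\<epsilon> x. \<Sum>(\<beta>, \<gamma>)\<leftarrow>L. partial_derivs \<beta> (u \<epsilon>) x * partial_derivs \<gamma> (v \<epsilon>) x) (\<lambda>\<epsilon>. 1 / \<epsilon> ^ N)"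
      using Cons.IH by blast
    obtain N1 where N1: "uniform_bigo K (\<lambda>\<epsilon>. partial_derivs \<beta> (u \<epsilon>)) (\<lambda>\<epsilon>. 1 / \<epsilon> ^ N1)"
      using assms(2) K unfolding moderate_nets_iff by blast
    obtain N2 where N2: "uniform_bigo K (\<lambda>\<epsilon>. partial_derivs \<gamma> (v \<epsilon>)) (\<lambda>\<epsilon>. 1 / \<epsilon> ^ N2)"
      using assms(3) K unfolding moderate_nets_iff by blast
    from uniform_bigo_mult[OF N1 N2]
    have "uniform_bigo K (\<lambda>\<epsilon> x. partial_derivs \<beta> (u \<epsilon>) x * partial_derivs \<gamma> (v \<epsilon>) x)
            (\<lambda>\<epsilon>. 1 / \<epsilon> ^ (N1 + N2))"
      by (simp add: power_add)
    from uniform_bigo_add_cmult[of K _ "\<lambda>\<epsilon>. 1 / \<epsilon> ^ (N + (N1 + N2))", where c = 1,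
        OF uniform_bigo_inverse_power_mono[OF this] uniform_bigo_inverse_power_mono[OF N]]
    show ?case
      unfolding p by auto
  qed
  from this[of "leibniz_splits \<alpha>"] obtain N where
    "uniform_bigo K (\<lambda>\<epsilon>. leibniz_sum \<alpha> (u \<epsilon>) (v \<epsilon>)) (\<lambda>\<epsilon>. 1 / \<epsilon> ^ N)"
    unfolding leibniz_sum_def[abs_def] by blast
  then have "uniform_bigo K (\<lambda>\<epsilon>. partial_derivs \<alpha> (\<lambda>x. u \<epsilon> x * v \<epsilon> x)) (\<lambda>\<epsilon>. 1 / \<epsilon> ^ N)"
  proof (rule uniform_bigo_cong)
    show "partial_derivs \<alpha> (\<lambda>x. u \<epsilon> x * v \<epsilon> x) x = leibniz_sum \<alpha> (u \<epsilon>) (v \<epsilon>) x"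
      if "\<epsilon> \<in> {0<..1}" "x \<in> K" for \<epsilon> x
      using that K by (intro partial_derivs_mult[OF \<open>open \<Omega>\<close>] smooth) auto
  qed
  then show "\<exists>N. uniform_bigo K (\<lambda>\<epsilon>. partial_derivs \<alpha> (\<lambda>x. u \<epsilon> x * v \<epsilon> x)) (\<lambda>\<epsilon>. 1 / \<epsilon> ^ N)" ..
qed

lemma negligible_nets_add_cmult:
  fixes c :: real
  assumes "open \<Omega>" "u \<in> negligible_nets \<Omega>" "v \<in> negligible_nets \<Omega>"
  shows "(\<lambda>\<epsilon> x. u \<epsilon> x + c * v \<epsilon> x) \<in> negligible_nets \<Omega>"
proof -
  have smooth: "C_infinity_on \<Omega> (u \<epsilon>)" "C_infinity_on \<Omega> (v \<epsilon>)" if "\<epsilon> \<in> {0<..1}" for \<epsilon>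
    using assms that by (auto simp: negligible_nets_iff)
  have "uniform_bigo K (\<lambda>\<epsilon>. partial_derivs \<alpha> (\<lambda>x. u \<epsilon> x + c * v \<epsilon> x)) (\<lambda>\<epsilon>. \<epsilon> ^ m)"
    if "compact K" "K \<subseteq> \<Omega>" for K \<alpha> m
  proof (rule uniform_bigo_cong)
    show "uniform_bigo K (\<lambda>\<epsilon> x. partial_derivs \<alpha> (u \<epsilon>) x + c * partial_derivs \<alpha> (v \<epsilon>) x) (\<lambda>\<epsilon>. \<epsilon> ^ m)"
      using assms that by (intro uniform_bigo_add_cmult) (auto simp: negligible_nets_iff)
    show "partial_derivs \<alpha> (\<lambda>x. u \<epsilon> x + c * v \<epsilon> x) x =
            partial_derivs \<alpha> (u \<epsilon>) x + c * partial_derivs \<alpha> (v \<epsilon>) x" if "\<epsilon> \<in> {0<..1}" "x \<in> K" for \<epsilon> x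
      using that \<open>K \<subseteq> \<Omega>\<close> by (intro partial_derivs_add_cmult[OF \<open>open \<Omega>\<close>] smooth) auto
  qed
  then show ?thesis
    using assms(1) smooth by (auto simp: negligible_nets_iff intro!: C_infinity_on_add_cmult)
qed

lemma zero_in_negligible_nets: "(\<lambda>\<epsilon> x. 0) \<in> negligible_nets (\<Omega> :: (real^'n::finite) set)"
proof -
  have "partial_derivs \<alpha> (\<lambda>x. 0) = (\<lambda>x::real^'n. 0)" for \<alpha>
    by (induction \<alpha>) (auto simp: partial_derivs_Cons partial_deriv_def)
  then show ?thesis
    using C_infinity_on_subset[OF C_infinity_on_const[of 0]]
    by (auto simp: negligible_nets_iff intro!: uniform_bigoI[of _ _ 0])
qed

lemma negligible_nets_local:
  assumes "open V" "V \<subseteq> \<Omega>" "n \<in> negligible_nets \<Omega>" "\<And>\<epsilon> x. x \<in> V \<Longrightarrow> w \<epsilon> x = n \<epsilon> x"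
  shows "w \<in> negligible_nets V"
proof -
  have n: "C_infinity_on V (n \<epsilon>)" if "\<epsilon> \<in> {0<..1}" for \<epsilon>
    using assms that by (auto simp: negligible_nets_iff intro: C_infinity_on_subset)
  have "uniform_bigo K (\<lambda>\<epsilon>. partial_derivs \<alpha> (w \<epsilon>)) (\<lambda>\<epsilon>. \<epsilon> ^ m)" if "compact K" "K \<subseteq> V" for K \<alpha> m
  proof (rule uniform_bigo_cong)
    show "uniform_bigo K (\<lambda>\<epsilon>. partial_derivs \<alpha> (n \<epsilon>)) (\<lambda>\<epsilon>. \<epsilon> ^ m)"
      using assms that by (auto simp: negligible_nets_iff)
    show "partial_derivs \<alpha> (w \<epsilon>) x = partial_derivs \<alpha> (n \<epsilon>) x" if "\<epsilon> \<in> {0<..1}" "x \<in> K" for \<epsilon> x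
      using that \<open>K \<subseteq> V\<close> assms(4) by (intro partial_derivs_local(1)[OF \<open>open V\<close> n]) auto
  qed
  moreover have "C_infinity_on V (w \<epsilon>)" if "\<epsilon> \<in> {0<..1}" for \<epsilon>
    using assms(4) by (rule partial_derivs_local(2)[OF \<open>open V\<close> n[OF that]])
  ultimately show ?thesis
    by (simp add: negligible_nets_iff)
qed

text \<open>
  By the mean value theorem the difference quotient of step \<open>h\<close>, which is at most \<open>2 * A / h\<close>, is the
  derivative at an intermediate point; moving from there to \<open>x\<close> changes it by at most \<open>B * h\<close>. The
  step is free, so that the two terms can be balanced.
\<close>
lemma deriv_bound_by_value_and_second_deriv:
  fixes x :: "real^'n::finite"
  assumes "C_infinity_on \<Omega> f" "h > 0"
    and seg: "\<And>t. t \<in> {0..h} \<Longrightarrow> x + t *\<^sub>R axis i 1 \<in> L" "L \<subseteq> \<Omega>"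
    and A: "\<And>y. y \<in> L \<Longrightarrow> \<bar>partial_derivs \<alpha> f y\<bar> \<le> A"
    and B: "\<And>y. y \<in> L \<Longrightarrow> \<bar>partial_derivs (i # i # \<alpha>) f y\<bar> \<le> B"
  shows "\<bar>partial_derivs (i # \<alpha>) f x\<bar> \<le> 2 * A / h + B * h"
proof -
  define F where "F \<beta> t = partial_derivs \<beta> f (x + t *\<^sub>R axis i 1)" for \<beta> t
  have F: "(F \<beta> has_real_derivative F (i # \<beta>) t) (at t)" if "t \<in> {0..h}" for \<beta> t
    unfolding F_def[abs_def] using seg that by (intro has_partial_deriv[OF assms(1)]) auto
  obtain z where z: "0 < z" "z < h" "F \<alpha> h - F \<alpha> 0 = (h - 0) * F (i # \<alpha>) z"
    using MVT2[OF \<open>h > 0\<close>, of "F \<alpha>" "F (i # \<alpha>)"] F by auto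
  have "\<bar>F (i # \<alpha>) z\<bar> = \<bar>F \<alpha> h - F \<alpha> 0\<bar> / h"
    using z \<open>h > 0\<close> by (simp add: abs_mult)
  also have "\<dots> \<le> 2 * A / h"
    using A[OF seg(1), of h] A[OF seg(1), of 0] \<open>h > 0\<close>
    by (intro divide_right_mono) (auto simp: F_def abs_le_iff)
  finally have "\<bar>F (i # \<alpha>) z\<bar> \<le> 2 * A / h" .
  moreover have "norm (F (i # \<alpha>) 0 - F (i # \<alpha>) z) \<le> B * norm (0 - z)"
  proof (rule field_differentiable_bound[where S = "{0..h}"])
    show "(F (i # \<alpha>) has_real_derivative F (i # i # \<alpha>) t) (at t within {0..h})" if "t \<in> {0..h}" for t
      using F[OF that] by (rule has_field_derivative_at_within)
    show "norm (F (i # i # \<alpha>) t) \<le> B" if "t \<in> {0..h}" for t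
      using B[OF seg(1)[OF that]] by (simp add: F_def)
  qed (use z in auto)
  moreover have "B * norm (0 - z) \<le> B * h"
    using z B[OF seg(1), of 0] \<open>h > 0\<close> by (intro mult_left_mono) auto
  ultimately have "\<bar>F (i # \<alpha>) 0\<bar> \<le> 2 * A / h + B * h"
    by simp
  then show ?thesis
    by (simp add: F_def)
qed

text \<open>
  Induction on the order of the derivative. With step \<open>h = \<epsilon>\<^sup>k\<close>, a bound \<open>\<epsilon>\<^sup>m\<^sup>+\<^sup>k\<close> on the lower derivative
  and \<open>\<epsilon>\<^sup>-\<^sup>N\<close> on the higher one give \<open>O(\<epsilon>\<^sup>m)\<close> as soon as \<open>k \<ge> N + m\<close>.
\<close>
lemma negligible_nets_if_zero_order_negligible:
  fixes v :: "real \<Rightarrow> real^'n::finite \<Rightarrow> real"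
  assumes "open \<Omega>" "v \<in> moderate_nets \<Omega>"
    and zero: "\<And>K m. compact K \<Longrightarrow> K \<subseteq> \<Omega> \<Longrightarrow> uniform_bigo K v (\<lambda>\<epsilon>. \<epsilon> ^ m)"
  shows "v \<in> negligible_nets \<Omega>"
proof -
  have smooth: "C_infinity_on \<Omega> (v \<epsilon>)" if "\<epsilon> \<in> {0<..1}" for \<epsilon>
    using assms that by (auto simp: moderate_nets_iff)
  have "uniform_bigo K (\<lambda>\<epsilon>. partial_derivs \<alpha> (v \<epsilon>)) (\<lambda>\<epsilon>. \<epsilon> ^ m)"
    if "compact K" "K \<subseteq> \<Omega>" for K \<alpha> m
    using that
  proof (induction \<alpha> arbitrary: K m)
    case Nil
    then show ?case
      using zero by simp
  next
    case (Cons i \<alpha>)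
    obtain d where d: "d > 0" "(\<Union>x\<in>K. cball x d) \<subseteq> \<Omega>"
      using compact_subset_open_imp_cball_epsilon_subset[OF Cons.prems(1) \<open>open \<Omega>\<close> Cons.prems(2)] .
    \<comment> \<open>The segments of the difference quotients leave \<open>K\<close>, so the induction hypothesis is applied on a
      compact neighbourhood of \<open>K\<close>.\<close>
    define L where "L = {x + y |x y. x \<in> K \<and> y \<in> cball 0 d}"
    have L: "compact L" "L \<subseteq> \<Omega>"
    proof -
      show "compact L"
        unfolding L_def using Cons.prems by (intro compact_sums) auto
      show "L \<subseteq> \<Omega>"
        using d by (fastforce simp: L_def dist_norm)
    qed
    obtain N where "uniform_bigo L (\<lambda>\<epsilon>. partial_derivs (i # i # \<alpha>) (v \<epsilon>)) (\<lambda>\<epsilon>. 1 / \<epsilon> ^ N)"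
      using assms(2) L unfolding moderate_nets_iff by blast
    then obtain B where
      B: "\<forall>\<^sub>F \<epsilon> in at_right 0. \<forall>x\<in>L. \<bar>partial_derivs (i # i # \<alpha>) (v \<epsilon>) x\<bar> \<le> B * (1 / \<epsilon> ^ N)"
      by (rule uniform_bigoE)
    \<comment> \<open>The successor makes \<open>\<epsilon>\<^sup>k\<close> tend to zero even if \<open>N = m = 0\<close>.\<close>
    define k where "k = Suc (N + m)"
    obtain A where
      A: "\<forall>\<^sub>F \<epsilon> in at_right 0. \<forall>x\<in>L. \<bar>partial_derivs \<alpha> (v \<epsilon>) x\<bar> \<le> A * \<epsilon> ^ (m + k)"
      using Cons.IH[OF L, of "m + k"] by (rule uniform_bigoE)
    have small: "\<forall>\<^sub>F \<epsilon> in at_right 0. \<epsilon> ^ k < d"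
      unfolding k_def using d(1) by (rule eventually_power_less)
    have "\<forall>\<^sub>F \<epsilon> in at_right 0. \<forall>x\<in>K. \<bar>partial_derivs (i # \<alpha>) (v \<epsilon>) x\<bar> \<le> (2 * A + \<bar>B\<bar>) * \<epsilon> ^ m"
      using A B small eventually_at_right_0_unit
    proof eventually_elim
      case (elim \<epsilon>)
      show ?case
      proof
        fix x assume "x \<in> K"
        have "\<bar>partial_derivs (i # \<alpha>) (v \<epsilon>) x\<bar> \<le>
                2 * (A * \<epsilon> ^ (m + k)) / \<epsilon> ^ k + B * (1 / \<epsilon> ^ N) * \<epsilon> ^ k"
        proof (rule deriv_bound_by_value_and_second_deriv[of \<Omega> _ _ _ _ L])
          show "x + t *\<^sub>R axis i 1 \<in> L" if "t \<in> {0..\<epsilon> ^ k}" for t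
          proof -
            have "t *\<^sub>R axis i (1::real) \<in> cball 0 d"
              using that elim(3) by (simp add: norm_axis_1 dist_norm)
            then show ?thesis
              using \<open>x \<in> K\<close> unfolding L_def by blast
          qed
        qed (use elim L smooth in auto)
        also have "\<dots> = 2 * A * \<epsilon> ^ m + B * \<epsilon> ^ Suc m"
          using elim by (simp add: k_def power_add field_simps)
        also have "B * \<epsilon> ^ Suc m \<le> \<bar>B\<bar> * \<epsilon> ^ m"
          using elim by (intro mult_mono power_decreasing) auto
        finally show "\<bar>partial_derivs (i # \<alpha>) (v \<epsilon>) x\<bar> \<le> (2 * A + \<bar>B\<bar>) * \<epsilon> ^ m"
          by (simp add: algebra_simps)
      qed
    qed
    then show ?case
      by (rule uniform_bigoI)
  qed
  then show ?thesis
    using smooth by (auto simp: negligible_nets_iff)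
qed

section \<open>From weighted square integrals to pointwise bounds\<close>

text \<open>
  The points \<open>y\<close> and \<open>x\<close> are joined by changing one coordinate at a time. Moving coordinates of \<open>y\<close>
  towards those of \<open>x\<close> never increases the distance from \<open>x\<close>, so the path stays in the ball and the
  one-dimensional mean value inequality applies to each leg.
\<close>
lemma smooth_lipschitz_on_cball:
  fixes x y :: "real^'n::finite"
  assumes f: "C_infinity_on \<Omega> f" and "cball x \<rho> \<subseteq> \<Omega>"
    and M: "\<And>i y. y \<in> cball x \<rho> \<Longrightarrow> \<bar>partial_derivs [i] f y\<bar> \<le> M"
    and "y \<in> cball x \<rho>"
  shows "\<bar>f y - f x\<bar> \<le> real CARD('n) * (M * \<rho>)"
proof -
  have "\<bar>f y - f x\<bar> \<le> real (card S) * (M * \<rho>)"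
    if "finite S" "y \<in> cball x \<rho>" "\<And>i. i \<notin> S \<Longrightarrow> y $ i = x $ i" for S y
    using that
  proof (induction S arbitrary: y rule: finite_induct)
    case empty
    then have "y = x"
      by (simp add: vec_eq_iff)
    then show ?case by simp
  next
    case (insert i S)
    define d where "d = y $ i - x $ i"
    \<comment> \<open>\<open>z 0\<close> has the \<open>i\<close>-th coordinate of \<open>x\<close>, and \<open>z d\<close> is \<open>y\<close>.\<close>
    define z where "z t = (y - d *\<^sub>R axis i 1) + t *\<^sub>R axis i 1" for t
    have z: "z t \<in> cball x \<rho>" if "\<bar>t\<bar> \<le> \<bar>d\<bar>" for t
    proof -
      have "norm (z t - x) \<le> norm (y - x)"
        using that by (intro norm_le_componentwise_cart) (auto simp: z_def d_def axis_def)
      then show ?thesis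
        using insert.prems(1) by (simp add: dist_norm norm_minus_commute)
    qed
    have d: "\<bar>d\<bar> \<le> \<rho>"
      using component_le_norm_cart[of "y - x" i] insert.prems(1)
      by (simp add: d_def dist_norm norm_minus_commute)
    have "norm (f (z d) - f (z 0)) \<le> M * norm (d - 0)"
    proof (rule field_differentiable_bound[where S = "{- \<bar>d\<bar>..\<bar>d\<bar>}"])
      fix t assume t: "t \<in> {- \<bar>d\<bar>..\<bar>d\<bar>}"
      then have zt: "z t \<in> cball x \<rho>"
        by (intro z) auto
      then have "z t \<in> \<Omega>"
        using assms(2) by blast
      then have "((\<lambda>t. f (z t)) has_real_derivative partial_derivs [i] f (z t)) (at t)"
        using has_partial_deriv[OF f, of "y - d *\<^sub>R axis i 1" t i "[]"] by (simp add: z_def)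
      then show "((\<lambda>t. f (z t)) has_real_derivative partial_derivs [i] f (z t)) (at t within {- \<bar>d\<bar>..\<bar>d\<bar>})"
        by (rule has_field_derivative_at_within)
      show "norm (partial_derivs [i] f (z t)) \<le> M"
        using M[OF zt] by simp
    qed auto
    moreover have "M * norm (d - 0) \<le> M * \<rho>"
      using d M[OF \<open>y \<in> cball x \<rho>\<close>] by (intro mult_left_mono) (auto intro: order_trans[OF abs_ge_zero])
    moreover have "\<bar>f (z 0) - f x\<bar> \<le> real (card S) * (M * \<rho>)"
    proof (rule insert.IH)
      show "z 0 \<in> cball x \<rho>"
        by (rule z) simp
      show "z 0 $ j = x $ j" if "j \<notin> S" for j
        using that insert.prems(2)[of j] by (auto simp: z_def d_def axis_def)
    qed
    moreover have "z d = y"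
      by (simp add: z_def)
    ultimately have "\<bar>f y - f x\<bar> \<le> M * \<rho> + real (card S) * (M * \<rho>)"
      by simp
    then show ?case
      using insert.hyps by (simp add: algebra_simps)
  qed
  from this[of UNIV y] show ?thesis
    using assms by simp
qed

lemma
  fixes f :: "'a::euclidean_space \<Rightarrow> real"
  assumes "compact K" "K \<subseteq> \<Omega>" "continuous_on \<Omega> f" "\<And>x. x \<in> \<Omega> - K \<Longrightarrow> f x = 0"
  shows set_integrable_compact_support: "set_integrable lborel \<Omega> f"
    and set_integral_compact_support_bound:
      "(\<And>x. x \<in> K \<Longrightarrow> \<bar>f x\<bar> \<le> B) \<Longrightarrow> \<bar>LINT x:\<Omega>|lborel. f x\<bar> \<le> B * measure lborel K"
proof -
  have eq: "(\<lambda>x. indicator \<Omega> x *\<^sub>R f x) = (\<lambda>x. indicator K x *\<^sub>R f x)"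
    using assms by (auto simp: fun_eq_iff indicator_def)
  have int: "integrable lborel (\<lambda>x. indicator K x *\<^sub>R f x)"
    using assms by (intro borel_integrable_compact) (auto intro: continuous_on_subset)
  then show "set_integrable lborel \<Omega> f"
    unfolding set_integrable_def eq .
  assume B: "\<And>x. x \<in> K \<Longrightarrow> \<bar>f x\<bar> \<le> B"
  have K: "K \<in> sets lborel"
    using assms(1) by (simp add: borel_compact)
  have fin: "emeasure lborel K < \<infinity>"
    using assms(1) by (intro emeasure_bounded_finite compact_imp_bounded)
  have "\<bar>LINT x|lborel. indicator K x *\<^sub>R f x\<bar> \<le> (LINT x|lborel. \<bar>indicator K x *\<^sub>R f x\<bar>)"
    using integral_norm_bound[of lborel "\<lambda>x. indicator K x *\<^sub>R f x"] by simp
  also have "\<dots> \<le> (LINT x|lborel. B * indicator K x)"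
    using B by (intro integral_mono integrable_abs[OF int] integrable_mult_right
        integrable_real_indicator K fin) (auto simp: indicator_def)
  also have "\<dots> = B * measure lborel K"
    using K by simp
  finally show "\<bar>LINT x:\<Omega>|lborel. f x\<bar> \<le> B * measure lborel K"
    unfolding set_lebesgue_integral_def eq .
qed

text \<open>
  If \<open>f\<close> varies by at most \<open>L\<close> on a ball around \<open>x\<close>, then \<open>f\<^sup>2 \<ge> (f x)\<^sup>2 / 2 - L\<^sup>2\<close> there, and the nonnegative
  rest of the integral may be dropped.
\<close>
lemma weighted_square_integral_lower_bound:
  fixes f \<psi> :: "real^'n::finite \<Rightarrow> real"
  assumes "continuous_on \<Omega> f" "continuous_on \<Omega> \<psi>"
    and K: "compact K" "K \<subseteq> \<Omega>" "\<And>x. x \<notin> K \<Longrightarrow> \<psi> x = 0"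
    and nonneg: "\<And>y. 0 \<le> \<psi> y"
    and \<rho>: "0 \<le> \<rho>" "cball x \<rho> \<subseteq> \<Omega>" "\<And>y. y \<in> cball x \<rho> \<Longrightarrow> \<delta> \<le> \<psi> y" "0 \<le> \<delta>"
    and L: "\<And>y. y \<in> cball x \<rho> \<Longrightarrow> \<bar>f y - f x\<bar> \<le> L"
  shows "\<delta> * ((f x)\<^sup>2 / 2 - L\<^sup>2) * (unit_ball_vol (real CARD('n)) * \<rho> ^ CARD('n)) \<le>
           (LINT y:\<Omega>|lborel. f y * (\<psi> y * f y))"
proof -
  let ?c = "\<delta> * ((f x)\<^sup>2 / 2 - L\<^sup>2)"
  have low: "?c \<le> f y * (\<psi> y * f y)" if y: "y \<in> cball x \<rho>" for y
  proof -
    have "(f x)\<^sup>2 \<le> 2 * (f y)\<^sup>2 + 2 * (f y - f x)\<^sup>2"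
      \<comment> \<open>The difference of the two sides is \<open>(2 * f y - f x)\<^sup>2\<close>.\<close>
      using zero_le_power2[of "2 * f y - f x"] by (simp add: power2_eq_square algebra_simps)
    moreover have "(f y - f x)\<^sup>2 \<le> L\<^sup>2"
      using L[OF y] by (metis abs_ge_zero order_trans power2_abs power_mono)
    ultimately have "(f x)\<^sup>2 / 2 - L\<^sup>2 \<le> (f y)\<^sup>2"
      by simp
    then have "?c \<le> \<delta> * (f y)\<^sup>2"
      using \<rho>(4) by (intro mult_left_mono)
    also have "\<dots> \<le> \<psi> y * (f y)\<^sup>2"
      using \<rho>(3)[OF y] by (intro mult_right_mono) auto
    finally show ?thesis
      by (simp add: power2_eq_square mult_ac)
  qed
  have "set_integrable lborel \<Omega> (\<lambda>y. f y * (\<psi> y * f y))"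
    using assms by (intro set_integrable_compact_support[OF K(1,2)] continuous_intros) auto
  then have int: "integrable lborel (\<lambda>y. indicator \<Omega> y *\<^sub>R (f y * (\<psi> y * f y)))"
    by (simp add: set_integrable_def)
  have fin: "emeasure lborel (cball x \<rho>) < \<infinity>"
    by (intro emeasure_bounded_finite bounded_cball)
  have "?c * (unit_ball_vol (real CARD('n)) * \<rho> ^ CARD('n)) = ?c * measure lborel (cball x \<rho>)"
    using content_cball[OF \<rho>(1), of x] by simp
  also have "\<dots> = (LINT y|lborel. ?c * indicator (cball x \<rho>) y)"
    by simp
  also have "\<dots> \<le> (LINT y|lborel. indicator \<Omega> y *\<^sub>R (f y * (\<psi> y * f y)))"
  proof (rule integral_mono[OF _ int])
    show "integrable lborel (\<lambda>y. ?c * indicator (cball x \<rho>) y)"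
      using fin by (intro integrable_mult_right integrable_real_indicator) auto
    have "0 \<le> f y * (\<psi> y * f y)" for y
      using nonneg[of y] by (metis mult.commute mult.left_commute mult_nonneg_nonneg zero_le_square)
    then show "?c * indicator (cball x \<rho>) y \<le> indicator \<Omega> y *\<^sub>R (f y * (\<psi> y * f y))" for y
      using low[of y] \<rho>(2) by (auto simp: indicator_def)
  qed
  finally show ?thesis
    by (simp add: set_lebesgue_integral_def)
qed

lemma moderate_nets_gradient_bound:
  fixes v :: "real \<Rightarrow> real^'n::finite \<Rightarrow> real"
  assumes "v \<in> moderate_nets \<Omega>" "compact K" "K \<subseteq> \<Omega>"
  obtains C N where "\<forall>\<^sub>F \<epsilon> in at_right 0. \<forall>i. \<forall>x\<in>K. \<bar>partial_derivs [i] (v \<epsilon>) x\<bar> \<le> C * (1 / \<epsilon> ^ N)"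
proof -
  have "\<forall>i. \<exists>N. uniform_bigo K (\<lambda>\<epsilon>. partial_derivs [i] (v \<epsilon>)) (\<lambda>\<epsilon>. 1 / \<epsilon> ^ N)"
    using assms unfolding moderate_nets_iff by blast
  then obtain N where N: "\<And>i. uniform_bigo K (\<lambda>\<epsilon>. partial_derivs [i] (v \<epsilon>)) (\<lambda>\<epsilon>. 1 / \<epsilon> ^ N i)"
    by metis
  have "\<forall>i. \<exists>C. \<forall>\<^sub>F \<epsilon> in at_right 0. \<forall>x\<in>K.
      \<bar>partial_derivs [i] (v \<epsilon>) x\<bar> \<le> C * (1 / \<epsilon> ^ sum N UNIV)"
  proof
    fix i
    show "\<exists>C. \<forall>\<^sub>F \<epsilon> in at_right 0. \<forall>x\<in>K.
        \<bar>partial_derivs [i] (v \<epsilon>) x\<bar> \<le> C * (1 / \<epsilon> ^ sum N UNIV)"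
      using uniform_bigo_inverse_power_mono[OF N[of i], of "sum N UNIV"]
      by (simp add: uniform_bigo_def member_le_sum)
  qed
  from choice[OF this] obtain C where C: "\<forall>i. \<forall>\<^sub>F \<epsilon> in at_right 0. \<forall>x\<in>K.
      \<bar>partial_derivs [i] (v \<epsilon>) x\<bar> \<le> C i * (1 / \<epsilon> ^ sum N UNIV)" ..
  have all_i: "\<forall>\<^sub>F \<epsilon> in at_right 0. \<forall>i. \<forall>x\<in>K.
      \<bar>partial_derivs [i] (v \<epsilon>) x\<bar> \<le> C i * (1 / \<epsilon> ^ sum N UNIV)"
    using C by (intro eventually_all_finite) blast
  have "\<forall>\<^sub>F \<epsilon> in at_right 0. \<forall>i. \<forall>x\<in>K. \<bar>partial_derivs [i] (v \<epsilon>) x\<bar> \<le> Max (range C) * (1 / \<epsilon> ^ sum N UNIV)"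
    using all_i eventually_at_right_0_unit
  proof eventually_elim
    case (elim \<epsilon>)
    show ?case
    proof (intro allI ballI)
      fix i x assume "x \<in> K"
      have "\<bar>partial_derivs [i] (v \<epsilon>) x\<bar> \<le> C i * (1 / \<epsilon> ^ sum N UNIV)"
        using elim(1) \<open>x \<in> K\<close> by blast
      also have "\<dots> \<le> Max (range C) * (1 / \<epsilon> ^ sum N UNIV)"
        using elim(2) by (intro mult_right_mono) auto
      finally show "\<bar>partial_derivs [i] (v \<epsilon>) x\<bar> \<le> Max (range C) * (1 / \<epsilon> ^ sum N UNIV)" .
    qed
  qed
  then show thesis
    by (rule that)
qed

text \<open>
  On balls of radius \<open>\<epsilon>\<^sup>k\<close> the moderate gradient lets \<open>v \<epsilon>\<close> vary by \<open>O(\<epsilon>\<^sup>m)\<close> only, while the volume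
  factor \<open>\<epsilon>\<^sup>k\<^sup>p\<close>, with \<open>p\<close> the dimension, is absorbed by requiring the integral to be
  \<open>O(\<epsilon>\<^sup>2\<^sup>m\<^sup>+\<^sup>k\<^sup>p)\<close>.
\<close>
lemma negligible_near_if_weighted_square_integral_negligible:
  fixes v :: "real \<Rightarrow> real^'n::finite \<Rightarrow> real"
  assumes "open \<Omega>" and v: "v \<in> moderate_nets \<Omega>" and "c \<in> \<Omega>"
    and \<psi>: "continuous_on \<Omega> \<psi>" "\<And>y. 0 \<le> \<psi> y" "0 < \<psi> c"
    and K: "compact K" "K \<subseteq> \<Omega>" "\<And>x. x \<notin> K \<Longrightarrow> \<psi> x = 0"
    and int: "(\<lambda>\<epsilon>. LINT x:\<Omega>|lborel. v \<epsilon> x * (\<psi> x * v \<epsilon> x)) \<in> negligible_reals"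
  shows "\<exists>U. open U \<and> c \<in> U \<and> uniform_bigo U v (\<lambda>\<epsilon>. \<epsilon> ^ m)"
proof -
  define \<delta> where "\<delta> = \<psi> c / 2"
  have "\<delta> > 0" "\<delta> < \<psi> c"
    using \<psi>(3) by (auto simp: \<delta>_def)
  have "open (\<Omega> \<inter> \<psi> -` {\<delta><..})"
    using \<psi>(1) \<open>open \<Omega>\<close> by (simp add: continuous_on_open_vimage inf_commute)
  moreover have "c \<in> \<Omega> \<inter> \<psi> -` {\<delta><..}"
    using \<open>c \<in> \<Omega>\<close> \<open>\<delta> < \<psi> c\<close> by simp
  ultimately obtain d where "d > 0" and d: "cball c d \<subseteq> \<Omega> \<inter> \<psi> -` {\<delta><..}"
    using open_contains_cball by blast
  have d\<Omega>: "cball c d \<subseteq> \<Omega>" and d\<delta>: "\<And>y. y \<in> cball c d \<Longrightarrow> \<delta> \<le> \<psi> y"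
    using d by (auto simp: subset_iff less_imp_le)
  obtain M N where M: "\<forall>\<^sub>F \<epsilon> in at_right 0. \<forall>i. \<forall>x\<in>cball c d.
      \<bar>partial_derivs [i] (v \<epsilon>) x\<bar> \<le> M * (1 / \<epsilon> ^ N)"
    using moderate_nets_gradient_bound[OF v compact_cball d\<Omega>] .
  \<comment> \<open>The ball of radius \<open>\<epsilon>\<^sup>k\<close> shrinks fast enough that gradient times radius, \<open>\<epsilon>\<^sup>k\<^sup>-\<^sup>N\<close>, is below \<open>\<epsilon>\<^sup>m\<close>.\<close>
  define k where "k = Suc (N + m)"
  define p where "p = CARD('n)"
  define \<omega> where "\<omega> = unit_ball_vol (real p)"
  have "\<omega> > 0"
    by (simp add: \<omega>_def unit_ball_vol_pos)
  have "(\<lambda>\<epsilon>. LINT x:\<Omega>|lborel. v \<epsilon> x * (\<psi> x * v \<epsilon> x)) \<in> O[at_right 0](\<lambda>\<epsilon>. \<epsilon> ^ (2 * m + k * p))"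
    using int by (simp add: negligible_reals_def)
  then obtain C where C: "\<forall>\<^sub>F \<epsilon> in at_right 0. norm (LINT x:\<Omega>|lborel. v \<epsilon> x * (\<psi> x * v \<epsilon> x)) \<le>
      C * norm (\<epsilon> ^ (2 * m + k * p))"
    by (rule landau_o.bigE)
  define D where "D = 2 * C / (\<delta> * \<omega>) + 2 * (real p * M)\<^sup>2"
  have "\<forall>\<^sub>F \<epsilon> in at_right (0::real). \<epsilon> ^ k < d / 2"
    unfolding k_def using \<open>d > 0\<close> by (intro eventually_power_less) simp
  with M C eventually_at_right_0_unit
  have "\<forall>\<^sub>F \<epsilon> in at_right 0. \<forall>x\<in>ball c (d / 2). \<bar>v \<epsilon> x\<bar> \<le> sqrt D * \<epsilon> ^ m"
  proof eventually_elim
    case (elim \<epsilon>)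
    let ?I = "LINT x:\<Omega>|lborel. v \<epsilon> x * (\<psi> x * v \<epsilon> x)"
    have \<epsilon>: "0 < \<epsilon>" "\<epsilon> < 1"
      using elim(3) by auto
    have smooth: "C_infinity_on \<Omega> (v \<epsilon>)"
      using v \<epsilon> by (simp add: moderate_nets_iff)
    show ?case
    proof
      fix x assume x: "x \<in> ball c (d / 2)"
      have sub: "cball x (\<epsilon> ^ k) \<subseteq> cball c d"
      proof
        fix y assume "y \<in> cball x (\<epsilon> ^ k)"
        then show "y \<in> cball c d"
          using x elim(4) dist_triangle[of c y x] by simp
      qed
      have L: "\<bar>v \<epsilon> y - v \<epsilon> x\<bar> \<le> real p * M * \<epsilon> ^ m" if y: "y \<in> cball x (\<epsilon> ^ k)" for y
      proof -
        have "\<bar>v \<epsilon> y - v \<epsilon> x\<bar> \<le> real CARD('n) * ((M * (1 / \<epsilon> ^ N)) * \<epsilon> ^ k)"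
          using elim(1) sub d\<Omega> y by (intro smooth_lipschitz_on_cball[OF smooth]) auto
        also have "\<dots> = real p * M * \<epsilon> ^ Suc m"
          using \<epsilon> by (simp add: p_def k_def power_add)
        also have "\<dots> \<le> real p * M * \<epsilon> ^ m"
        proof (rule mult_left_mono)
          have "0 \<le> M * (1 / \<epsilon> ^ N)"
            using elim(1) x \<open>d > 0\<close> order_trans[OF abs_ge_zero] by (metis centre_in_cball less_imp_le)
          then have "0 \<le> M"
            using zero_less_power[OF \<epsilon>(1), of N] by (auto simp: zero_le_divide_iff)
          then show "0 \<le> real p * M"
            by simp
        qed (use \<epsilon> in \<open>auto intro: power_decreasing\<close>)
        finally show ?thesis .
      qed
      have "\<delta> * ((v \<epsilon> x)\<^sup>2 / 2 - (real p * M * \<epsilon> ^ m)\<^sup>2) * (\<omega> * (\<epsilon> ^ k) ^ p) \<le> ?I"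
        unfolding \<omega>_def p_def
        using \<epsilon> d\<Omega> sub L \<open>\<delta> > 0\<close> d\<delta>
        by (intro weighted_square_integral_lower_bound[OF C_infinity_on_imp_continuous_on'[OF smooth] \<psi>(1) K \<psi>(2)])
          (auto simp: p_def)
      also have "\<dots> \<le> C * \<epsilon> ^ (2 * m + k * p)"
        using elim(2) \<epsilon> by simp
      also have "\<dots> = C * \<epsilon> ^ (2 * m) * (\<epsilon> ^ k) ^ p"
        by (simp add: power_add power_mult)
      finally have "(\<delta> * \<omega>) * ((v \<epsilon> x)\<^sup>2 / 2 - (real p * M * \<epsilon> ^ m)\<^sup>2) * (\<epsilon> ^ k) ^ p \<le>
          C * \<epsilon> ^ (2 * m) * (\<epsilon> ^ k) ^ p"
        by (simp add: mult_ac)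
      then have "(\<delta> * \<omega>) * ((v \<epsilon> x)\<^sup>2 / 2 - (real p * M * \<epsilon> ^ m)\<^sup>2) \<le> C * \<epsilon> ^ (2 * m)"
        using \<epsilon> by (simp add: mult_le_cancel_right)
      then have "(v \<epsilon> x)\<^sup>2 / 2 - (real p * M * \<epsilon> ^ m)\<^sup>2 \<le> C * \<epsilon> ^ (2 * m) / (\<delta> * \<omega>)"
        using \<open>\<delta> > 0\<close> \<open>\<omega> > 0\<close> by (simp add: pos_le_divide_eq mult.commute)
      moreover have "(real p * M * \<epsilon> ^ m)\<^sup>2 = (real p * M)\<^sup>2 * (\<epsilon> ^ m)\<^sup>2"
        by (rule power_mult_distrib)
      moreover have "\<epsilon> ^ (2 * m) = (\<epsilon> ^ m)\<^sup>2"
        by (rule power_even_eq)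
      ultimately have "(v \<epsilon> x)\<^sup>2 \<le> D * (\<epsilon> ^ m)\<^sup>2"
        unfolding D_def by (simp add: algebra_simps)
      then have "sqrt ((v \<epsilon> x)\<^sup>2) \<le> sqrt (D * (\<epsilon> ^ m)\<^sup>2)"
        by (rule real_sqrt_le_mono)
      then show "\<bar>v \<epsilon> x\<bar> \<le> sqrt D * \<epsilon> ^ m"
        using \<epsilon> by (simp add: real_sqrt_mult)
    qed
  qed
  then have "uniform_bigo (ball c (d / 2)) v (\<lambda>\<epsilon>. \<epsilon> ^ m)"
    by (rule uniform_bigoI)
  then show ?thesis
    using \<open>d > 0\<close> by (intro exI[of _ "ball c (d / 2)"]) auto
qed

section \<open>The quotient algebra\<close>

lemma zero_colombeau_algebra: "\<zero>\<^bsub>colombeau_algebra \<Omega>\<^esub> = negligible_nets \<Omega>"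
  by (simp add: colombeau_algebra_def FactRing_def)

lemma zero_generalized_reals: "\<zero>\<^bsub>generalized_reals\<^esub> = negligible_reals"
  by (simp add: generalized_reals_def FactRing_def)

lemma colombeau_class_eq:
  "colombeau_class \<Omega> v = {(\<lambda>\<epsilon> x. n \<epsilon> x + v \<epsilon> x) |n. n \<in> negligible_nets \<Omega>}"
  by (auto simp: colombeau_class_def a_r_coset_def' moderate_ring_def)

lemma carrier_colombeau_algebra:
  "carrier (colombeau_algebra \<Omega>) = colombeau_class \<Omega> ` moderate_nets \<Omega>"
  by (auto simp: colombeau_algebra_def FactRing_def A_RCOSETS_def' colombeau_class_def moderate_ring_def)

lemma mult_colombeau_algebra:
  "U \<otimes>\<^bsub>colombeau_algebra \<Omega>\<^esub> W = (\<Union>a\<in>U. \<Union>b\<in>W. colombeau_class \<Omega> (\<lambda>\<epsilon> x. a \<epsilon> x * b \<epsilon> x))"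
  by (simp add: colombeau_algebra_def FactRing_def rcoset_mult_def colombeau_class_def moderate_ring_def)

lemma self_in_colombeau_class: "v \<in> colombeau_class \<Omega> v"
  using zero_in_negligible_nets[of \<Omega>] by (force simp: colombeau_class_eq)

lemma colombeau_class_negligible:
  assumes "open \<Omega>" "v \<in> negligible_nets \<Omega>"
  shows "colombeau_class \<Omega> v = negligible_nets \<Omega>"
proof
  show "colombeau_class \<Omega> v \<subseteq> negligible_nets \<Omega>"
    using negligible_nets_add_cmult[OF assms(1) _ assms(2), of _ 1] by (auto simp: colombeau_class_eq)
  show "negligible_nets \<Omega> \<subseteq> colombeau_class \<Omega> v"
  proof
    fix n assume "n \<in> negligible_nets \<Omega>"
    from negligible_nets_add_cmult[OF assms(1) this assms(2), of "-1"]
    have "(\<lambda>\<epsilon> x. n \<epsilon> x - v \<epsilon> x) \<in> negligible_nets \<Omega>"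
      by simp
    then show "n \<in> colombeau_class \<Omega> v"
      by (force simp: colombeau_class_eq)
  qed
qed

lemma generalized_real_class_eq_zeroD:
  assumes "generalized_real_class x = \<zero>\<^bsub>generalized_reals\<^esub>"
  shows "x \<in> negligible_reals"
proof -
  have "(\<lambda>\<epsilon>. 0) \<in> negligible_reals"
    by (simp add: negligible_reals_def)
  then have "x \<in> generalized_real_class x"
    by (force simp: generalized_real_class_def a_r_coset_def' moderate_real_ring_def)
  then show ?thesis
    using assms by (simp add: zero_generalized_reals)
qed

text \<open>
  The class restricts to zero on the open set \<open>\<Omega> - K\<close>, because every representative coincides there
  with a negligible net. So the support is what remains of the compact set \<open>K\<close> after removing
  open sets.
\<close>
lemma colombeau_class_compact_support:
  assumes "open \<Omega>" "w \<in> moderate_nets \<Omega>" and K: "compact K" "K \<subseteq> \<Omega>"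
    and w: "\<And>\<epsilon> x. x \<in> \<Omega> - K \<Longrightarrow> w \<epsilon> x = 0"
  shows "colombeau_class \<Omega> w \<in> colombeau_compact_support \<Omega>"
proof -
  let ?W = "colombeau_class \<Omega> w"
  define \<V> where "\<V> = {V. open V \<and> V \<subseteq> \<Omega> \<and> colombeau_restrict V ?W = \<zero>\<^bsub>colombeau_algebra V\<^esub>}"
  have "open (\<Omega> - K)"
    using assms by (intro open_Diff compact_imp_closed)
  have "colombeau_class (\<Omega> - K) v = negligible_nets (\<Omega> - K)" if v: "v \<in> ?W" for v
  proof (rule colombeau_class_negligible[OF \<open>open (\<Omega> - K)\<close>])
    obtain n where n: "n \<in> negligible_nets \<Omega>" "v = (\<lambda>\<epsilon> x. n \<epsilon> x + w \<epsilon> x)"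
      using v by (auto simp: colombeau_class_eq)
    show "v \<in> negligible_nets (\<Omega> - K)"
      by (rule negligible_nets_local[OF \<open>open (\<Omega> - K)\<close> _ n(1)]) (auto simp: n(2) w)
  qed
  then have "colombeau_restrict (\<Omega> - K) ?W = \<zero>\<^bsub>colombeau_algebra (\<Omega> - K)\<^esub>"
    using self_in_colombeau_class[of w \<Omega>]
    by (auto simp: colombeau_restrict_def zero_colombeau_algebra)
  then have "\<Omega> - K \<in> \<V>"
    using \<open>open (\<Omega> - K)\<close> by (auto simp: \<V>_def)
  then have "\<Omega> - \<Union>\<V> = K - \<Union>\<V>"
    using K by blast
  moreover have "compact (K - \<Union>\<V>)"
    using K by (intro compact_diff open_Union) (auto simp: \<V>_def)
  ultimately have "compact (colombeau_support \<Omega> ?W)"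
    by (simp add: colombeau_support_def \<V>_def)
  then show ?thesis
    using assms(2) by (auto simp: colombeau_compact_support_def carrier_colombeau_algebra)
qed

lemma uniform_bigo_moderate_mult_negligible:
  assumes "v \<in> moderate_nets \<Omega>" "n \<in> negligible_nets \<Omega>" "compact K" "K \<subseteq> \<Omega>"
  shows "uniform_bigo K (\<lambda>\<epsilon> x. v \<epsilon> x * n \<epsilon> x) (\<lambda>\<epsilon>. \<epsilon> ^ m)"
proof -
  obtain N where N: "uniform_bigo K (\<lambda>\<epsilon>. partial_derivs [] (v \<epsilon>)) (\<lambda>\<epsilon>. 1 / \<epsilon> ^ N)"
    using assms unfolding moderate_nets_iff by blast
  have "uniform_bigo K (\<lambda>\<epsilon>. partial_derivs [] (n \<epsilon>)) (\<lambda>\<epsilon>. \<epsilon> ^ (N + m))"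
    using assms unfolding negligible_nets_iff by blast
  from uniform_bigo_mult[OF N this]
  have "uniform_bigo K (\<lambda>\<epsilon> x. v \<epsilon> x * n \<epsilon> x) (\<lambda>\<epsilon>. 1 / \<epsilon> ^ N * \<epsilon> ^ (N + m))"
    by simp
  then show ?thesis
    by (rule uniform_bigo_mono) (auto simp: power_add)
qed

lemma negligible_nets_subset_moderate_nets: "negligible_nets \<Omega> \<subseteq> moderate_nets \<Omega>"
proof
  fix n assume n: "n \<in> negligible_nets \<Omega>"
  have "\<exists>N::nat. uniform_bigo K (\<lambda>\<epsilon>. partial_derivs \<alpha> (n \<epsilon>)) (\<lambda>\<epsilon>. 1 / \<epsilon> ^ N)"
    if "compact K \<and> K \<subseteq> \<Omega>" for K \<alpha>
  proof -
    have "uniform_bigo K (\<lambda>\<epsilon>. partial_derivs \<alpha> (n \<epsilon>)) (\<lambda>\<epsilon>. \<epsilon> ^ 0)"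
      using n that unfolding negligible_nets_iff by blast
    then show ?thesis
      by (intro exI[of _ 0]) simp
  qed
  then show "n \<in> moderate_nets \<Omega>"
    using n by (simp add: moderate_nets_iff negligible_nets_iff)
qed

text \<open>
  A representative of the product class differs from \<open>v * w\<close> by \<open>n + v * n2 + w * n1 + n1 * n2\<close> with
  negligible \<open>n, n1, n2\<close>. Comparing integrals only takes the size of this error and the continuity
  of the representative, so nothing is said about derivatives.
\<close>
lemma colombeau_class_mult_diff:
  assumes v: "v \<in> moderate_nets \<Omega>" and w: "w \<in> moderate_nets \<Omega>"
    and f: "f \<in> colombeau_class \<Omega> v \<otimes>\<^bsub>colombeau_algebra \<Omega>\<^esub> colombeau_class \<Omega> w"
  shows "compact K \<Longrightarrow> K \<subseteq> \<Omega> \<Longrightarrow> uniform_bigo K (\<lambda>\<epsilon> x. f \<epsilon> x - v \<epsilon> x * w \<epsilon> x) (\<lambda>\<epsilon>. \<epsilon> ^ m)"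
    and "\<epsilon> \<in> {0<..1} \<Longrightarrow> continuous_on \<Omega> (f \<epsilon>)"
proof -
  obtain n n1 n2 where n: "n \<in> negligible_nets \<Omega>" "n1 \<in> negligible_nets \<Omega>" "n2 \<in> negligible_nets \<Omega>"
    and f: "f = (\<lambda>\<epsilon> x. n \<epsilon> x + (n1 \<epsilon> x + v \<epsilon> x) * (n2 \<epsilon> x + w \<epsilon> x))"
    using f by (auto simp: mult_colombeau_algebra colombeau_class_eq)
  have mod: "n \<in> moderate_nets \<Omega>" "n1 \<in> moderate_nets \<Omega>" "n2 \<in> moderate_nets \<Omega>"
    using n negligible_nets_subset_moderate_nets by auto
  show "continuous_on \<Omega> (f \<epsilon>)" if "\<epsilon> \<in> {0<..1}"
    unfolding f by (intro continuous_on_add continuous_on_mult moderate_nets_imp_continuous_on[OF _ that] mod v w)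
  assume K: "compact K" "K \<subseteq> \<Omega>"
  have "uniform_bigo K (\<lambda>\<epsilon>. partial_derivs [] (n \<epsilon>)) (\<lambda>\<epsilon>. \<epsilon> ^ m)"
    using n(1) K unfolding negligible_nets_iff by blast
  then have "uniform_bigo K n (\<lambda>\<epsilon>. \<epsilon> ^ m)"
    by simp
  note this[THEN uniform_bigo_add_cmult, where c = 1,
      OF uniform_bigo_moderate_mult_negligible[OF v n(3) K],
      THEN uniform_bigo_add_cmult, where c = 1,
      OF uniform_bigo_moderate_mult_negligible[OF w n(2) K],
      THEN uniform_bigo_add_cmult, where c = 1,
      OF uniform_bigo_moderate_mult_negligible[OF mod(2) n(3) K]]
  then show "uniform_bigo K (\<lambda>\<epsilon> x. f \<epsilon> x - v \<epsilon> x * w \<epsilon> x) (\<lambda>\<epsilon>. \<epsilon> ^ m)"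
    by (rule uniform_bigo_cong) (simp add: f algebra_simps)
qed

text \<open>
  The integral of a class is computed from some representative \<open>f\<close> supported in some compact set \<open>L\<close>.
  Its difference from \<open>v * w\<close> is uniformly negligible and lives on the compact set \<open>K \<union> L\<close>, which has
  finite volume, so both integrals differ by a negligible net.
\<close>
lemma integral_negligible_if_colombeau_integral_eq_zero:
  fixes v w :: "real \<Rightarrow> real^'n::finite \<Rightarrow> real"
  assumes v: "v \<in> moderate_nets \<Omega>" and w: "w \<in> moderate_nets \<Omega>"
    and K: "compact K" "K \<subseteq> \<Omega>" "\<And>\<epsilon> x. x \<in> \<Omega> - K \<Longrightarrow> w \<epsilon> x = 0"
    and zero: "colombeau_integral \<Omega> (colombeau_class \<Omega> v \<otimes>\<^bsub>colombeau_algebra \<Omega>\<^esub> colombeau_class \<Omega> w) =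
                 \<zero>\<^bsub>generalized_reals\<^esub>"
  shows "(\<lambda>\<epsilon>. LINT x:\<Omega>|lborel. v \<epsilon> x * w \<epsilon> x) \<in> negligible_reals"
proof -
  let ?W = "colombeau_class \<Omega> v \<otimes>\<^bsub>colombeau_algebra \<Omega>\<^esub> colombeau_class \<Omega> w"
  let ?vw = "\<lambda>\<epsilon> x. v \<epsilon> x * w \<epsilon> x"
  define P where "P f \<longleftrightarrow> f \<in> ?W \<and> (\<exists>K. compact K \<and> K \<subseteq> \<Omega> \<and>
      (\<forall>\<epsilon>\<in>{0<..1}. closure (support_on \<Omega> (f \<epsilon>)) \<subseteq> K))" for f
  define f where "f = (SOME f. P f)"
  have "P ?vw"
    unfolding P_def
  proof (intro conjI exI[of _ K] ballI K(1,2))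
    show "?vw \<in> ?W"
      using self_in_colombeau_class unfolding mult_colombeau_algebra by blast
    show "closure (support_on \<Omega> (?vw \<epsilon>)) \<subseteq> K" for \<epsilon>
      using K by (intro closure_minimal compact_imp_closed) (auto simp: support_on_def)
  qed
  then have "P f"
    unfolding f_def by (rule someI[of P])
  then obtain L where f: "f \<in> ?W" and L: "compact L" "L \<subseteq> \<Omega>"
    and supp: "\<And>\<epsilon>. \<epsilon> \<in> {0<..1} \<Longrightarrow> closure (support_on \<Omega> (f \<epsilon>)) \<subseteq> L"
    by (auto simp: P_def)
  have f0: "f \<epsilon> x = 0" if "\<epsilon> \<in> {0<..1}" "x \<in> \<Omega> - L" for \<epsilon> x
    using supp[OF that(1)] that(2) closure_subset[of "support_on \<Omega> (f \<epsilon>)"] by (auto simp: support_on_def)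
  have "generalized_real_class (\<lambda>\<epsilon>. LINT x:\<Omega>|lborel. f \<epsilon> x) = \<zero>\<^bsub>generalized_reals\<^esub>"
    using zero by (simp add: colombeau_integral_def Let_def f_def P_def)
  then have If: "(\<lambda>\<epsilon>. LINT x:\<Omega>|lborel. f \<epsilon> x) \<in> negligible_reals"
    by (rule generalized_real_class_eq_zeroD)
  define n where "n \<epsilon> x = f \<epsilon> x - v \<epsilon> x * w \<epsilon> x" for \<epsilon> x
  have KL: "compact (K \<union> L)" "K \<union> L \<subseteq> \<Omega>"
    using K L by auto
  have cont: "continuous_on \<Omega> (f \<epsilon>)" "continuous_on \<Omega> (n \<epsilon>)" if "\<epsilon> \<in> {0<..1}" for \<epsilon>
  proof -
    show f_cont: "continuous_on \<Omega> (f \<epsilon>)"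
      using colombeau_class_mult_diff(2)[OF v w f that] .
    show "continuous_on \<Omega> (n \<epsilon>)"
      unfolding n_def[abs_def]
      by (intro continuous_on_diff continuous_on_mult f_cont moderate_nets_imp_continuous_on[OF v that]
          moderate_nets_imp_continuous_on[OF w that])
  qed
  have n0: "n \<epsilon> x = 0" if "\<epsilon> \<in> {0<..1}" "x \<in> \<Omega> - (K \<union> L)" for \<epsilon> x
    using f0[OF that(1), of x] K(3)[of x \<epsilon>] that(2) by (simp add: n_def)
  have int: "(LINT x:\<Omega>|lborel. v \<epsilon> x * w \<epsilon> x) =
               (LINT x:\<Omega>|lborel. f \<epsilon> x) - (LINT x:\<Omega>|lborel. n \<epsilon> x)" if "\<epsilon> \<in> {0<..1}" for \<epsilon>
  proof -
    have "set_integrable lborel \<Omega> (f \<epsilon>)"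
      using f0[OF that] cont(1)[OF that] by (intro set_integrable_compact_support[OF L])
    moreover have "set_integrable lborel \<Omega> (n \<epsilon>)"
      using n0[OF that] cont(2)[OF that] by (intro set_integrable_compact_support[OF KL])
    ultimately show ?thesis
      using set_integral_diff(2)[of lborel \<Omega> "f \<epsilon>" "n \<epsilon>"] by (simp add: n_def)
  qed
  have In: "(\<lambda>\<epsilon>. LINT x:\<Omega>|lborel. n \<epsilon> x) \<in> O[at_right 0](\<lambda>\<epsilon>. \<epsilon> ^ m)" for m
  proof -
    have "uniform_bigo (K \<union> L) n (\<lambda>\<epsilon>. \<epsilon> ^ m)"
      using colombeau_class_mult_diff(1)[OF v w f KL, of m] by (simp add: n_def[abs_def])
    then obtain C where "\<forall>\<^sub>F \<epsilon> in at_right 0. \<forall>x\<in>K \<union> L. \<bar>n \<epsilon> x\<bar> \<le> C * \<epsilon> ^ m"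
      by (rule uniform_bigoE)
    then have "\<forall>\<^sub>F \<epsilon> in at_right 0. norm (LINT x:\<Omega>|lborel. n \<epsilon> x) \<le>
        (C * measure lborel (K \<union> L)) * norm (\<epsilon> ^ m)"
      using eventually_at_right_0_unit
    proof eventually_elim
      case (elim \<epsilon>)
      then have "\<epsilon> \<in> {0<..1}"
        by simp
      then have "\<bar>LINT x:\<Omega>|lborel. n \<epsilon> x\<bar> \<le> (C * \<epsilon> ^ m) * measure lborel (K \<union> L)"
        using elim(1) n0 by (intro set_integral_compact_support_bound[OF KL] cont) auto
      then show ?case
        using elim(2) by (simp add: mult_ac)
    qed
    then show ?thesis
      by (rule bigoI)
  qed
  have "(\<lambda>\<epsilon>. LINT x:\<Omega>|lborel. v \<epsilon> x * w \<epsilon> x) \<in> O[at_right 0](\<lambda>\<epsilon>. \<epsilon> ^ m)" for m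
  proof -
    have "(\<lambda>\<epsilon>. (LINT x:\<Omega>|lborel. f \<epsilon> x) - (LINT x:\<Omega>|lborel. n \<epsilon> x)) \<in> O[at_right 0](\<lambda>\<epsilon>. \<epsilon> ^ m)"
      using If In by (intro sum_in_bigo) (auto simp: negligible_reals_def)
    moreover have "\<forall>\<^sub>F \<epsilon> in at_right 0. (LINT x:\<Omega>|lborel. v \<epsilon> x * w \<epsilon> x) =
        (LINT x:\<Omega>|lborel. f \<epsilon> x) - (LINT x:\<Omega>|lborel. n \<epsilon> x)"
      using eventually_at_right_0_unit by (rule eventually_mono) (simp add: int)
    ultimately show ?thesis
      by (simp add: landau_o.big.in_cong)
  qed
  then show ?thesis
    by (simp add: negligible_reals_def)
qed

section \<open>The fundamental lemma\<close>

theorem lemma3p3: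
  fixes \<Omega> :: "(real^'p::finite) set"
    and u :: "(real \<Rightarrow> real^'p \<Rightarrow> real) set"
  assumes "open \<Omega>" and "connected \<Omega>" and "bounded \<Omega>" and "smooth_boundary \<Omega>"
    and "u \<in> carrier (colombeau_algebra \<Omega>)"
    and "\<And>\<phi>. \<phi> \<in> colombeau_compact_support \<Omega> \<Longrightarrow>
           colombeau_integral \<Omega> (u \<otimes>\<^bsub>colombeau_algebra \<Omega>\<^esub> \<phi>) = \<zero>\<^bsub>generalized_reals\<^esub>"
  shows "u = \<zero>\<^bsub>colombeau_algebra \<Omega>\<^esub>"
proof -
  obtain v where v: "v \<in> moderate_nets \<Omega>" and u: "u = colombeau_class \<Omega> v"
    using assms(5) by (auto simp: carrier_colombeau_algebra)
  have "\<exists>U. open U \<and> c \<in> U \<and> uniform_bigo U v (\<lambda>\<epsilon>. \<epsilon> ^ m)" if "c \<in> \<Omega>" for c m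
  proof -
    obtain \<psi> K where \<psi>: "C_infinity_on UNIV \<psi>" "\<And>x. 0 \<le> \<psi> x" "0 < \<psi> c"
      and K: "compact K" "K \<subseteq> \<Omega>" "\<And>x. x \<notin> K \<Longrightarrow> \<psi> x = 0"
      using smooth_bump[OF \<open>open \<Omega>\<close> \<open>c \<in> \<Omega>\<close>] by metis
    have \<psi>\<Omega>: "C_infinity_on \<Omega> \<psi>"
      using \<psi>(1) by (rule C_infinity_on_subset) simp
    define w where "w \<epsilon> x = \<psi> x * v \<epsilon> x" for \<epsilon> x
    have w: "w \<in> moderate_nets \<Omega>"
      unfolding w_def[abs_def] by (intro moderate_nets_mult moderate_nets_const \<psi>\<Omega> v \<open>open \<Omega>\<close>)
    have w0: "w \<epsilon> x = 0" if "x \<in> \<Omega> - K" for \<epsilon> x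
      using that K(3) by (simp add: w_def)
    have "colombeau_integral \<Omega> (u \<otimes>\<^bsub>colombeau_algebra \<Omega>\<^esub> colombeau_class \<Omega> w) = \<zero>\<^bsub>generalized_reals\<^esub>"
      using w0 by (intro assms(6) colombeau_class_compact_support[OF \<open>open \<Omega>\<close> w K(1,2)])
    then have "(\<lambda>\<epsilon>. LINT x:\<Omega>|lborel. v \<epsilon> x * w \<epsilon> x) \<in> negligible_reals"
      unfolding u using w0 by (intro integral_negligible_if_colombeau_integral_eq_zero[OF v w K(1,2)])
    then have "(\<lambda>\<epsilon>. LINT x:\<Omega>|lborel. v \<epsilon> x * (\<psi> x * v \<epsilon> x)) \<in> negligible_reals"
      by (simp add: w_def)
    then show ?thesis
      using \<psi>(2,3) K
      by (intro negligible_near_if_weighted_square_integral_negligible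
          [OF \<open>open \<Omega>\<close> v \<open>c \<in> \<Omega>\<close> C_infinity_on_imp_continuous_on'[OF \<psi>\<Omega>]])
  qed
  then have "uniform_bigo K v (\<lambda>\<epsilon>. \<epsilon> ^ m)" if "compact K" "K \<subseteq> \<Omega>" for K m
    using that by (intro uniform_bigo_compact) auto
  then have "v \<in> negligible_nets \<Omega>"
    by (rule negligible_nets_if_zero_order_negligible[OF \<open>open \<Omega>\<close> v])
  then show ?thesis
    unfolding u zero_colombeau_algebra by (rule colombeau_class_negligible[OF \<open>open \<Omega>\<close>])
qed

end
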